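(* Let $R$ be a ring with unity, let $\mathcal{X}$ be a semibrick of left $R$-modules and let $M\in\mathrm{Filt}(\mathcal{X})$ with an $\mathcal{X}$-filtration $(M_\lambda,\lambda\le\mu)$. Then there exist a filtration $(N_\lambda,\lambda\le\mu)$ of $M$ and an ordinal $\xi\le\mu$ such that $N_\xi=\mathrm{soc}_{\mathcal{X}}M$. In particular, $M/\mathrm{soc}_{\mathcal{X}}M\in\mathrm{Filt}(\mathcal{X})$.
   Context: A brick is a finitely presented left $R$-module whose endomorphism ring is a division ring. Two non-isomorphic bricks $X,Y$ are orthogonal if $\mathrm{Hom}(X,Y)=\mathrm{Hom}(Y,X)=0$. A semibrick is a class $\mathcal{X}$ of pairwise orthogonal bricks. A filtration of a module $M$ is an ascending chain $(M_\lambda,\lambda\le\mu)$ of submodules of $M$ ($\mu$ an ordinal) with $M_0=0$, $M_\mu=M$ and $M_\nu=\bigcup_{\lambda<\nu}M_\lambda$ for every limit ordinal $\nu\le\mu$. It is an $\mathcal{X}$-filtration if each consecutive factor $M_{\lambda+1}/M_\lambda$ ($\lambda<\mu$) is isomorphic to a module in $\mathcal{X}$. $\mathrm{Filt}(\mathcal{X})$ is the class of all modules admitting an $\mathcal{X}$-filtration. For $M\in\mathrm{Filt}(\mathcal{X})$ the $\mathcal{X}$-socle (also called the $\mathcal{X}$-trace) of $M$ is $\mathrm{soc}_{\mathcal{X}}M=\sum_{X\in\mathcal{X},\,f\in\mathrm{Hom}(X,M)}\mathrm{Im}\,f$. *)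

theory Defs
  imports "HOL-Algebra.Module" "HOL-Algebra.AbelCoset"
begin

section \<open>Left modules over a not necessarily commutative ring\<close>

text \<open>
  The library locale \<open>module\<close> requires a commutative ring of scalars. The record type
  \<open>('a, 'b) module\<close>, the locale \<open>submodule\<close> and the coset operations do not, and are reused here.
  The ring multiplication and unit fields of a module record are junk.
\<close>

locale left_module = R?: ring R + M?: abelian_group M for R (structure) and M (structure) +
  assumes smult_closed [simp, intro]:
      "\<lbrakk>a \<in> carrier R; x \<in> carrier M\<rbrakk> \<Longrightarrow> a \<odot>\<^bsub>M\<^esub> x \<in> carrier M"
    and smult_l_distr:
      "\<lbrakk>a \<in> carrier R; b \<in> carrier R; x \<in> carrier M\<rbrakk> \<Longrightarrow>
        (a \<oplus> b) \<odot>\<^bsub>M\<^esub> x = a \<odot>\<^bsub>M\<^esub> x \<oplus>\<^bsub>M\<^esub> b \<odot>\<^bsub>M\<^esub> x"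
    and smult_r_distr:
      "\<lbrakk>a \<in> carrier R; x \<in> carrier M; y \<in> carrier M\<rbrakk> \<Longrightarrow>
        a \<odot>\<^bsub>M\<^esub> (x \<oplus>\<^bsub>M\<^esub> y) = a \<odot>\<^bsub>M\<^esub> x \<oplus>\<^bsub>M\<^esub> a \<odot>\<^bsub>M\<^esub> y"
    and smult_assoc1:
      "\<lbrakk>a \<in> carrier R; b \<in> carrier R; x \<in> carrier M\<rbrakk> \<Longrightarrow>
        (a \<otimes> b) \<odot>\<^bsub>M\<^esub> x = a \<odot>\<^bsub>M\<^esub> (b \<odot>\<^bsub>M\<^esub> x)"
    and smult_one [simp]: "x \<in> carrier M \<Longrightarrow> \<one> \<odot>\<^bsub>M\<^esub> x = x"

text \<open>
  Homomorphisms are extensional functions, so that a homomorphism is determined by its values on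
  the carrier and \<open>Hom(M, N) = 0\<close> can be stated as an equality of sets.
\<close>

definition lmod_hom ::
    "('a, 'r) ring_scheme \<Rightarrow> ('a, 'b) module \<Rightarrow> ('a, 'c) module \<Rightarrow> ('b \<Rightarrow> 'c) set" where
  "lmod_hom R M N =
    {f \<in> carrier M \<rightarrow>\<^sub>E carrier N.
      (\<forall>x\<in>carrier M. \<forall>y\<in>carrier M. f (x \<oplus>\<^bsub>M\<^esub> y) = f x \<oplus>\<^bsub>N\<^esub> f y) \<and>
      (\<forall>a\<in>carrier R. \<forall>x\<in>carrier M. f (a \<odot>\<^bsub>M\<^esub> x) = a \<odot>\<^bsub>N\<^esub> f x)}"

definition zero_hom :: "('a, 'b) module \<Rightarrow> ('a, 'c) module \<Rightarrow> 'b \<Rightarrow> 'c" where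
  "zero_hom M N = (\<lambda>x\<in>carrier M. \<zero>\<^bsub>N\<^esub>)"

definition lmod_iso :: "('a, 'r) ring_scheme \<Rightarrow> ('a, 'b) module \<Rightarrow> ('a, 'c) module \<Rightarrow> bool" where
  "lmod_iso R M N \<longleftrightarrow> (\<exists>f\<in>lmod_hom R M N. bij_betw f (carrier M) (carrier N))"

definition End_ring :: "('a, 'r) ring_scheme \<Rightarrow> ('a, 'b) module \<Rightarrow> ('b \<Rightarrow> 'b) ring" where
  "End_ring R M =
    \<lparr>carrier = lmod_hom R M M,
     mult = (\<lambda>f g. compose (carrier M) f g),
     one = (\<lambda>x\<in>carrier M. x),
     zero = zero_hom M M,
     add = (\<lambda>f g. \<lambda>x\<in>carrier M. f x \<oplus>\<^bsub>M\<^esub> g x)\<rparr>"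

text \<open>The quotient of \<open>M\<close> by a submodule \<open>H\<close>, with the cosets of \<open>H\<close> as elements.\<close>

definition quot_module :: "('a, 'b) module \<Rightarrow> 'b set \<Rightarrow> ('a, 'b set) module" where
  "quot_module M H =
    \<lparr>carrier = a_rcosets\<^bsub>M\<^esub> H,
     mult = undefined, one = undefined,
     zero = H,
     add = (\<lambda>A B. A <+>\<^bsub>M\<^esub> B),
     smult = (\<lambda>a A. \<Union>x\<in>A. H +>\<^bsub>M\<^esub> (a \<odot>\<^bsub>M\<^esub> x))\<rparr>"

text \<open>The sum of a family of submodules is generated by their union.\<close>

definition gen_submodule ::
    "('a, 'r) ring_scheme \<Rightarrow> ('a, 'b) module \<Rightarrow> 'b set \<Rightarrow> 'b set" where
  "gen_submodule R M S = \<Inter>{H. submodule H R M \<and> S \<subseteq> H}"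

text \<open>The left module \<open>R\<^sup>n\<close>, consisting of functions that are \<open>undefined\<close> outside \<open>{..<n}\<close>.\<close>

definition free_lmod :: "('a, 'r) ring_scheme \<Rightarrow> nat \<Rightarrow> ('a, nat \<Rightarrow> 'a) module" where
  "free_lmod R n =
    \<lparr>carrier = {..<n} \<rightarrow>\<^sub>E carrier R,
     mult = undefined, one = undefined,
     zero = (\<lambda>i\<in>{..<n}. \<zero>\<^bsub>R\<^esub>),
     add = (\<lambda>u v. \<lambda>i\<in>{..<n}. u i \<oplus>\<^bsub>R\<^esub> v i),
     smult = (\<lambda>a u. \<lambda>i\<in>{..<n}. a \<otimes>\<^bsub>R\<^esub> u i)\<rparr>"

text \<open>An exact sequence \<open>R\<^sup>m \<rightarrow> R\<^sup>n \<rightarrow> M \<rightarrow> 0\<close>.\<close>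

definition finitely_presented :: "('a, 'r) ring_scheme \<Rightarrow> ('a, 'b) module \<Rightarrow> bool" where
  "finitely_presented R M \<longleftrightarrow>
    (\<exists>m n. \<exists>g\<in>lmod_hom R (free_lmod R m) (free_lmod R n). \<exists>f\<in>lmod_hom R (free_lmod R n) M.
      f ` carrier (free_lmod R n) = carrier M \<and>
      g ` carrier (free_lmod R m) = {u \<in> carrier (free_lmod R n). f u = \<zero>\<^bsub>M\<^esub>})"


section \<open>Semibricks\<close>

definition division_ring :: "('a, 'r) ring_scheme \<Rightarrow> bool" where
  "division_ring D \<longleftrightarrow> ring D \<and> \<one>\<^bsub>D\<^esub> \<noteq> \<zero>\<^bsub>D\<^esub> \<and> Units D = carrier D - {\<zero>\<^bsub>D\<^esub>}"

definition brick :: "('a, 'r) ring_scheme \<Rightarrow> ('a, 'b) module \<Rightarrow> bool" where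
  "brick R X \<longleftrightarrow> left_module R X \<and> finitely_presented R X \<and> division_ring (End_ring R X)"

definition orthogonal_bricks ::
    "('a, 'r) ring_scheme \<Rightarrow> ('a, 'b) module \<Rightarrow> ('a, 'b) module \<Rightarrow> bool" where
  "orthogonal_bricks R X Y \<longleftrightarrow>
    lmod_hom R X Y = {zero_hom X Y} \<and> lmod_hom R Y X = {zero_hom Y X}"

text \<open>
  A semibrick is a class of modules on one common (arbitrary) carrier type. This is no restriction
  up to isomorphism, since every finitely presented \<open>R\<close>-module is isomorphic to a module with
  carrier of type \<open>(nat \<Rightarrow> 'a) set\<close>. Orthogonality is a condition on non-isomorphic members, so
  that several isomorphic copies of the same brick are allowed.
\<close>

definition semibrick :: "('a, 'r) ring_scheme \<Rightarrow> ('a, 'b) module set \<Rightarrow> bool" where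
  "semibrick R \<X> \<longleftrightarrow>
    (\<forall>X\<in>\<X>. brick R X) \<and>
    (\<forall>X\<in>\<X>. \<forall>Y\<in>\<X>. \<not> lmod_iso R X Y \<longrightarrow> orthogonal_bricks R X Y)"


section \<open>Filtrations\<close>

text \<open>
  An ordinal \<open>\<mu>\<close> is represented by an element \<open>\<mu>\<close> of the field of a well-order \<open>r\<close>. The ordinals
  \<open>\<alpha> \<le> \<mu>\<close> and \<open>\<alpha> < \<mu>\<close> are then the elements of \<open>under r \<mu>\<close> and \<open>underS r \<mu>\<close>, and \<open>\<alpha> + 1\<close> is
  \<open>wo_rel.suc r {\<alpha>}\<close>.
\<close>

definition is_zero_ord :: "'i rel \<Rightarrow> 'i \<Rightarrow> bool" where
  "is_zero_ord r \<nu> \<longleftrightarrow> \<nu> \<in> Field r \<and> underS r \<nu> = {}"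

definition is_limit_ord :: "'i rel \<Rightarrow> 'i \<Rightarrow> bool" where
  "is_limit_ord r \<nu> \<longleftrightarrow>
    \<nu> \<in> Field r \<and> underS r \<nu> \<noteq> {} \<and> (\<forall>\<alpha>\<in>underS r \<nu>. wo_rel.suc r {\<alpha>} \<noteq> \<nu>)"

definition filtration ::
    "('a, 'r) ring_scheme \<Rightarrow> ('a, 'b) module \<Rightarrow> 'i rel \<Rightarrow> 'i \<Rightarrow> ('i \<Rightarrow> 'b set) \<Rightarrow> bool" where
  "filtration R M r \<mu> F \<longleftrightarrow>
    Well_order r \<and> \<mu> \<in> Field r \<and>
    (\<forall>\<alpha>\<in>under r \<mu>. submodule (F \<alpha>) R M) \<and>
    (\<forall>\<beta>\<in>under r \<mu>. \<forall>\<alpha>\<in>under r \<beta>. F \<alpha> \<subseteq> F \<beta>) \<and>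
    (\<forall>\<nu>\<in>under r \<mu>. is_zero_ord r \<nu> \<longrightarrow> F \<nu> = {\<zero>\<^bsub>M\<^esub>}) \<and>
    F \<mu> = carrier M \<and>
    (\<forall>\<nu>\<in>under r \<mu>. is_limit_ord r \<nu> \<longrightarrow> F \<nu> = (\<Union>\<alpha>\<in>underS r \<nu>. F \<alpha>))"

definition X_filtration ::
    "('a, 'r) ring_scheme \<Rightarrow> ('a, 'x) module set \<Rightarrow> ('a, 'b) module \<Rightarrow>
      'i rel \<Rightarrow> 'i \<Rightarrow> ('i \<Rightarrow> 'b set) \<Rightarrow> bool" where
  "X_filtration R \<X> M r \<mu> F \<longleftrightarrow>
    filtration R M r \<mu> F \<and>
    (\<forall>\<alpha>\<in>underS r \<mu>. \<exists>X\<in>\<X>.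
      lmod_iso R (quot_module (M\<lparr>carrier := F (wo_rel.suc r {\<alpha>})\<rparr>) (F \<alpha>)) X)"

text \<open>
  The existential quantifier over ordinals has to range over a fixed type. Well-orders on
  \<open>'b set\<close> suffice: if the modules in \<open>\<X>\<close> are nonzero (as bricks are), then an
  \<open>\<X>\<close>-filtration \<open>F\<close> is strictly increasing, so \<open>\<alpha> \<mapsto> F \<alpha>\<close> embeds \<open>{\<alpha>. \<alpha> \<le> \<mu>}\<close> into \<open>'b set\<close>.
\<close>

definition in_Filt ::
    "('a, 'r) ring_scheme \<Rightarrow> ('a, 'x) module set \<Rightarrow> ('a, 'b) module \<Rightarrow> bool" where
  "in_Filt R \<X> M \<longleftrightarrow>
    left_module R M \<and> (\<exists>(r :: 'b set rel) \<mu> F. X_filtration R \<X> M r \<mu> F)"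

definition X_socle ::
    "('a, 'r) ring_scheme \<Rightarrow> ('a, 'x) module set \<Rightarrow> ('a, 'b) module \<Rightarrow> 'b set" where
  "X_socle R \<X> M = gen_submodule R M (\<Union>X\<in>\<X>. \<Union>f\<in>lmod_hom R X M. f ` carrier X)"

end

(*
  Let I be the set of those alpha for which some map from a member of the semibrick to M has image
  in F(alpha+1) but not in F alpha.  Such an image T alpha is a complement of F alpha in F(alpha+1),
  since nonzero maps between members of a semibrick are isomorphisms.  By transfinite induction,
  every map from a brick X to M has its image in the sum P alpha of the T beta (beta < alpha) as
  soon as it has it in F alpha; the limit steps use that X is finitely generated.  Hence the socle S
  is P mu, and S meets F alpha in P alpha.  The factors of the chain P alpha from 0 to S and of the
  chain F alpha + S from S to M are therefore zero or factors of F, the latter occurring for alpha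
  in I and for alpha outside I respectively.  Deleting repetitions gives a filtration of M through
  S, and dividing the second chain by S gives one of M/S.
*)

theory Submission
  imports Defs
begin

section \<open>Well-ordered chains of sets\<close>


text \<open>In general the length \<mu> cannot be kept for an \<open>\<X>\<close>-filtration through
  the socle. Over the integers, let \<open>\<X>\<close> consist of Z/p and let M be a countable
  direct sum of copies of Z/p^2: there is an \<open>\<X>\<close>-filtration of type \<omega>, but
  the socle and the quotient by it are both infinite, so one through the socle is longer. Hence the
  filtration over the given well-order, with free factors, and the \<open>\<X>\<close>-filtration
  through the socle are separate results, and the latter brings its own well-order. Building that
  order from the order types of \<open>I\<close> and its complement would take ordinal arithmetic
  across types. Instead both chains keep the index set of \<open>F\<close>, each standing still
  where the other moves, and the indices are then forgotten. The sum of the complements has to be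
  intersected with every \<open>F \<alpha>\<close>, and intersections do not distribute over sums.
  What saves the argument is that \<open>T \<beta>\<close> meets \<open>F \<beta>\<close> only in 0:
  an element of the sum that lies in \<open>F \<alpha>\<close> has no component at or beyond
  \<alpha>.\<close>

lemma ord_cases:
  assumes "\<nu> \<in> Field r"
  obtains (zero) "is_zero_ord r \<nu>"
  | (suc) \<alpha> where "\<alpha> \<in> underS r \<nu>" "\<nu> = wo_rel.suc r {\<alpha>}"
  | (limit) "is_limit_ord r \<nu>"
  using assms unfolding is_zero_ord_def is_limit_ord_def by metis

text \<open>\<open>wo_rel.suc\<close> is the least strict upper bound and means nothing when there
  is none; the assumption \<alpha> < \<mu> supplies one. The third fact, that the ordinals below
  \<alpha> + 1 are those up to \<alpha>, drives the successor steps.\<close>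

lemma suc_ord:
  assumes r: "Well_order r" and \<alpha>: "\<alpha> \<in> underS r \<mu>"
  shows "\<alpha> \<in> underS r (wo_rel.suc r {\<alpha>})"
    and "wo_rel.suc r {\<alpha>} \<in> under r \<mu>"
    and "underS r (wo_rel.suc r {\<alpha>}) = under r \<alpha>"
proof -
  interpret wo_rel r using r by (simp add: wo_rel_def)
  have F: "{\<alpha>} \<subseteq> Field r" "\<mu> \<in> Field r" using \<alpha> by (auto simp: underS_def Field_def)
  have A: "\<mu> \<in> AboveS {\<alpha>}" using \<alpha> F by (auto simp: underS_def AboveS_def)
  have g: "suc {\<alpha>} \<noteq> \<alpha>" "(\<alpha>, suc {\<alpha>}) \<in> r" using suc_greater[of "{\<alpha>}" \<alpha>] F A by auto
  then show 1: "\<alpha> \<in> underS (suc {\<alpha>})" by (simp add: underS_def)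
  show "suc {\<alpha>} \<in> under \<mu>" using suc_least_AboveS[OF A] by (simp add: under_def)
  have a: "antisym r" using r by (simp add: order_on_defs)
  have t: "trans r" using r by (simp add: order_on_defs)
  show "underS (suc {\<alpha>}) = under \<alpha>"
  proof (intro subset_antisym subsetI)
    fix \<beta> assume b: "\<beta> \<in> underS (suc {\<alpha>})"
    show "\<beta> \<in> under \<alpha>"
    proof (rule ccontr)
      assume "\<beta> \<notin> under \<alpha>"
      then have "(\<alpha>, \<beta>) \<in> r" "\<beta> \<noteq> \<alpha>"
        using b F TOTALS by (auto simp: under_def underS_def Field_def)
      then have "\<beta> \<in> AboveS {\<alpha>}" by (auto simp: AboveS_def Field_def)
      then show False using suc_least_AboveS[of \<beta>] b a by (auto simp: underS_def antisym_def)
    qed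
  next
    fix \<beta> assume "\<beta> \<in> under \<alpha>"
    then show "\<beta> \<in> underS (suc {\<alpha>})"
      using g a t by (auto simp: under_def underS_def antisym_def dest: transD)
  qed
qed

lemma under_trans:
  assumes "Well_order r" "\<alpha> \<in> under r \<beta>" "\<beta> \<in> under r \<gamma>"
  shows "\<alpha> \<in> under r \<gamma>"
  using assms by (auto simp: order_on_defs under_def dest: transD)

lemma underS_under: "\<alpha> \<in> underS r \<beta> \<Longrightarrow> \<alpha> \<in> under r \<beta>"
  by (simp add: under_def underS_def)

lemma underS_under_trans:
  assumes "Well_order r" "\<alpha> \<in> underS r \<beta>" "\<beta> \<in> under r \<gamma>"
  shows "\<alpha> \<in> underS r \<gamma>"
  using assms by (auto simp: order_on_defs under_def underS_def antisym_def dest: transD)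

lemma limit_ord_suc:
  assumes r: "Well_order r" and \<nu>: "is_limit_ord r \<nu>" and \<alpha>: "\<alpha> \<in> underS r \<nu>"
  shows "wo_rel.suc r {\<alpha>} \<in> underS r \<nu>"
  using suc_ord(2)[OF r \<alpha>] \<nu> \<alpha> by (auto simp: is_limit_ord_def underS_def under_def)

lemma well_order_linear:
  assumes "Well_order r" "\<alpha> \<in> under r \<mu>" "\<beta> \<in> under r \<mu>"
  obtains "\<alpha> \<in> under r \<beta>" | "\<beta> \<in> underS r \<alpha>"
proof -
  interpret wo_rel r using assms(1) by (simp add: wo_rel_def)
  show thesis using assms that TOTALS by (auto simp: under_def underS_def Field_def)
qed

text \<open>A filtration says nothing beyond \<mu>, so the induction is confined to the ordinals up
  to \<mu>. The successor case accordingly runs over \<alpha> < \<mu>, which keeps \<alpha> + 1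
  within range.\<close>

lemma ord_induct [consumes 2, case_names zero suc limit]:
  assumes r: "Well_order r" and \<nu>: "\<nu> \<in> under r \<mu>"
    and z: "\<And>\<nu>. \<nu> \<in> under r \<mu> \<Longrightarrow> is_zero_ord r \<nu> \<Longrightarrow> P \<nu>"
    and s: "\<And>\<alpha>. \<alpha> \<in> underS r \<mu> \<Longrightarrow> P \<alpha> \<Longrightarrow> P (wo_rel.suc r {\<alpha>})"
    and l: "\<And>\<nu>. \<nu> \<in> under r \<mu> \<Longrightarrow> is_limit_ord r \<nu> \<Longrightarrow> (\<And>\<alpha>. \<alpha> \<in> underS r \<nu> \<Longrightarrow> P \<alpha>) \<Longrightarrow> P \<nu>"
  shows "P \<nu>"
proof -
  interpret wo_rel r using r by (simp add: wo_rel_def)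
  show ?thesis
    using \<nu>
  proof (induction \<nu> rule: well_order_induct)
    case (1 \<nu>)
    have f: "\<nu> \<in> Field r" using 1 by (auto simp: under_def Field_def)
    have IH: "P \<alpha>" if "\<alpha> \<in> underS \<nu>" for \<alpha>
      using 1 that under_trans[OF r underS_under[OF that]] by (auto simp: underS_def)
    from f show ?case
    proof (cases \<nu> rule: ord_cases)
      case zero then show ?thesis using z 1 by blast
    next
      case (suc \<alpha>) then show ?thesis using s IH underS_under_trans[OF r _ 1(2)] by blast
    next
      case limit then show ?thesis using l IH 1 by blast
    qed
  qed
qed

lemma well_order_least:
  assumes r: "Well_order r" and S: "S \<subseteq> under r \<mu>" "S \<noteq> {}"
  obtains \<alpha> where "\<alpha> \<in> S" "\<And>\<beta>. \<beta> \<in> S \<Longrightarrow> \<alpha> \<in> under r \<beta>"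
proof -
  interpret wo_rel r using r by (simp add: wo_rel_def)
  have "S \<subseteq> Field r" using S by (auto simp: under_def Field_def)
  then show thesis using that[of "minim S"] minim_in minim_least S by (auto simp: under_def)
qed

section \<open>Chains of subsets without an index set\<close>

text \<open>
  Filtrations as sets of submodules well-ordered by inclusion: forgetting the indices discards
  the repetitions of a weakly increasing family, and makes concatenation a union.
\<close>

definition well_chain :: "('b set \<Rightarrow> 'b set \<Rightarrow> bool) \<Rightarrow> 'b set \<Rightarrow> 'b set \<Rightarrow> 'b set set \<Rightarrow> bool" where
  "well_chain \<Phi> A B \<C> \<longleftrightarrow>
    A \<in> \<C> \<and> B \<in> \<C> \<and> (\<forall>C\<in>\<C>. A \<subseteq> C \<and> C \<subseteq> B) \<and> (\<forall>\<D>\<subseteq>\<C>. \<D> \<noteq> {} \<longrightarrow> \<Inter>\<D> \<in> \<D>) \<and>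
    (\<forall>C\<in>\<C>. C \<noteq> A \<longrightarrow> C \<subseteq> \<Union>{D \<in> \<C>. D \<subset> C} \<or>
      (\<exists>K\<in>\<C>. K \<subset> C \<and> (\<forall>D\<in>\<C>. D \<subset> C \<longrightarrow> D \<subseteq> K) \<and> \<Phi> K C))"

lemma well_chainD:
  assumes "well_chain \<Phi> A B \<C>"
  shows "A \<in> \<C>" and "B \<in> \<C>" and "\<And>C. C \<in> \<C> \<Longrightarrow> A \<subseteq> C" and "\<And>C. C \<in> \<C> \<Longrightarrow> C \<subseteq> B"
    and "\<And>\<D>. \<D> \<subseteq> \<C> \<Longrightarrow> \<D> \<noteq> {} \<Longrightarrow> \<Inter>\<D> \<in> \<D>"
    and "\<And>C. C \<in> \<C> \<Longrightarrow> C \<noteq> A \<Longrightarrow> C \<subseteq> \<Union>{D \<in> \<C>. D \<subset> C} \<or>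
      (\<exists>K\<in>\<C>. K \<subset> C \<and> (\<forall>D\<in>\<C>. D \<subset> C \<longrightarrow> D \<subseteq> K) \<and> \<Phi> K C)"
  using assms unfolding well_chain_def by simp_all

text \<open>All members of the lower chain lie below \<open>B\<close> and all members of the upper
  one above it, so least members, unions and immediate predecessors are those of one of the two
  chains. The common endpoint \<open>B\<close> is treated as the top of the lower chain.\<close>

lemma well_chain_append:
  assumes 1: "well_chain \<Phi> A B \<C>" and 2: "well_chain \<Phi> B C \<D>"
  shows "well_chain \<Phi> A C (\<C> \<union> \<D>)"
proof -
  have *: "\<And>X. X \<in> \<C> \<Longrightarrow> A \<subseteq> X \<and> X \<subseteq> B" "\<And>X. X \<in> \<D> \<Longrightarrow> B \<subseteq> X \<and> X \<subseteq> C"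
    "A \<in> \<C>" "B \<in> \<C>" "B \<in> \<D>" "C \<in> \<D>"
    using well_chainD(1-4)[OF 1] well_chainD(1-4)[OF 2] by simp_all
  have "\<Inter>\<E> \<in> \<E>" if E: "\<E> \<subseteq> \<C> \<union> \<D>" "\<E> \<noteq> {}" for \<E>
  proof (cases "\<E> \<inter> \<C> = {}")
    case True
    then have "\<E> \<subseteq> \<D>" using E by blast
    then show ?thesis using well_chainD(5)[OF 2] E(2) by blast
  next
    case False
    have EC: "\<Inter>(\<E> \<inter> \<C>) \<in> \<E> \<inter> \<C>"
      using well_chainD(5)[OF 1 _ False] by blast
    \<comment> \<open>Members of the upper chain contain \<open>B\<close> and hence every member of
      the lower one, so they do not affect the intersection.\<close>
    have "\<Inter>(\<E> \<inter> \<C>) = \<Inter>\<E>"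
    proof
      show "\<Inter>(\<E> \<inter> \<C>) \<subseteq> \<Inter>\<E>"
      proof (rule Inter_greatest)
        fix Y assume Y: "Y \<in> \<E>"
        show "\<Inter>(\<E> \<inter> \<C>) \<subseteq> Y"
        proof (cases "Y \<in> \<C>")
          case True
          then show ?thesis using Y by (simp add: Inter_lower)
        next
          case False
          then have "B \<subseteq> Y" using Y E *(2) by auto
          moreover have "\<Inter>(\<E> \<inter> \<C>) \<subseteq> B"
            using *(1)[of "\<Inter>(\<E> \<inter> \<C>)"] EC by simp
          ultimately show ?thesis by (rule order_trans[rotated])
        qed
      qed
    qed blast
    then show ?thesis using EC by simp
  qed
  moreover have "X \<subseteq> \<Union>{D \<in> \<C> \<union> \<D>. D \<subset> X} \<or>
      (\<exists>K\<in>\<C> \<union> \<D>. K \<subset> X \<and> (\<forall>D\<in>\<C> \<union> \<D>. D \<subset> X \<longrightarrow> D \<subseteq> K) \<and> \<Phi> K X)"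
    if X: "X \<in> \<C> \<union> \<D>" "X \<noteq> A" for X
  proof (cases "X \<in> \<C>")
    case True
    then have e: "D \<in> \<C>" if "D \<in> \<C> \<union> \<D>" "D \<subset> X" for D
      using that * by blast
    have "X \<subseteq> \<Union>{D \<in> \<C>. D \<subset> X} \<or>
      (\<exists>K\<in>\<C>. K \<subset> X \<and> (\<forall>D\<in>\<C>. D \<subset> X \<longrightarrow> D \<subseteq> K) \<and> \<Phi> K X)"
      using well_chainD(6)[OF 1 True] X(2) by blast
    then show ?thesis
    proof
      assume "X \<subseteq> \<Union>{D \<in> \<C>. D \<subset> X}" then show ?thesis by blast
    next
      assume "\<exists>K\<in>\<C>. K \<subset> X \<and> (\<forall>D\<in>\<C>. D \<subset> X \<longrightarrow> D \<subseteq> K) \<and> \<Phi> K X"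
      then obtain K where K: "K \<in> \<C>" "K \<subset> X" "\<forall>D\<in>\<C>. D \<subset> X \<longrightarrow> D \<subseteq> K" "\<Phi> K X"
        by blast
      then show ?thesis using e by (intro disjI2 bexI[of _ K]) auto
    qed
  next
    case False
    then have X': "X \<in> \<D>" "X \<noteq> B" using X * by auto
    then have e: "D \<subseteq> B" if "D \<in> \<C>" for D using that * by blast
    have "X \<subseteq> \<Union>{D \<in> \<D>. D \<subset> X} \<or>
      (\<exists>K\<in>\<D>. K \<subset> X \<and> (\<forall>D\<in>\<D>. D \<subset> X \<longrightarrow> D \<subseteq> K) \<and> \<Phi> K X)"
      by (rule well_chainD(6)[OF 2 X'])
    then show ?thesis
    proof
      assume "X \<subseteq> \<Union>{D \<in> \<D>. D \<subset> X}" then show ?thesis by blast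
    next
      assume "\<exists>K\<in>\<D>. K \<subset> X \<and> (\<forall>D\<in>\<D>. D \<subset> X \<longrightarrow> D \<subseteq> K) \<and> \<Phi> K X"
      then obtain K where K: "K \<in> \<D>" "K \<subset> X" "\<forall>D\<in>\<D>. D \<subset> X \<longrightarrow> D \<subseteq> K" "\<Phi> K X"
        by blast
      have "D \<subseteq> K" if "D \<in> \<C>" for D
        using e[OF that] *(2)[OF K(1)] by (auto dest: subsetD)
      then show ?thesis using K by (intro disjI2 bexI[of _ K]) auto
    qed
  qed
  moreover have "A \<subseteq> X \<and> X \<subseteq> C" if "X \<in> \<C> \<union> \<D>" for X
    using that
  proof
    assume "X \<in> \<C>"
    then show ?thesis using *(1)[of X] *(2)[OF *(5)] by auto
  next
    assume "X \<in> \<D>"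
    then show ?thesis using *(2)[of X] *(1)[OF *(4)] by auto
  qed
  ultimately show ?thesis
    unfolding well_chain_def using *(3,6) by simp
qed

text \<open>Passing to the set of values absorbs the steps at which \<open>G\<close> is constant;
  this is why a successor step may be an equality.\<close>

lemma well_chain_image:
  assumes r: "Well_order r" and \<mu>: "\<mu> \<in> Field r"
    and mono: "\<And>\<alpha> \<beta>. \<beta> \<in> under r \<mu> \<Longrightarrow> \<alpha> \<in> under r \<beta> \<Longrightarrow> G \<alpha> \<subseteq> G \<beta>"
    and zero: "\<And>\<nu>. \<nu> \<in> under r \<mu> \<Longrightarrow> is_zero_ord r \<nu> \<Longrightarrow> G \<nu> = A"
    and suc: "\<And>\<alpha>. \<alpha> \<in> underS r \<mu> \<Longrightarrow>
      G (wo_rel.suc r {\<alpha>}) = G \<alpha> \<or> \<Phi> (G \<alpha>) (G (wo_rel.suc r {\<alpha>}))"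
    and limit: "\<And>\<nu>. \<nu> \<in> under r \<mu> \<Longrightarrow> is_limit_ord r \<nu> \<Longrightarrow> G \<nu> \<subseteq> (\<Union>\<alpha>\<in>underS r \<nu>. G \<alpha>)"
  shows "well_chain \<Phi> A (G \<mu>) (G ` under r \<mu>)"
proof -
  interpret wo_rel r using r by (simp add: wo_rel_def)
  have refl: "\<mu> \<in> under \<mu>" using \<mu> REFL by (simp add: Refl_under_in)
  obtain z where z: "z \<in> under \<mu>" "\<And>\<beta>. \<beta> \<in> under \<mu> \<Longrightarrow> z \<in> under \<beta>"
    using well_order_least[OF r subset_refl] refl by blast
  have "is_zero_ord r z"
    unfolding is_zero_ord_def
  proof
    show "z \<in> Field r" using z by (auto simp: under_def Field_def)
    show "underS z = {}"
      using z(2) under_trans[OF r _ z(1)] ANTISYM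
      by (fastforce simp: under_def underS_def antisym_def)
  qed
  then have Gz: "G z = A" using zero z by blast
  have least: "\<exists>\<alpha>\<in>under \<mu>. G \<alpha> \<in> \<D> \<and> (\<forall>\<beta>\<in>under \<mu>. G \<beta> \<in> \<D> \<longrightarrow> \<alpha> \<in> under \<beta>)"
    if "\<D> \<subseteq> G ` under \<mu>" "\<D> \<noteq> {}" for \<D>
  proof -
    have "{\<alpha> \<in> under \<mu>. G \<alpha> \<in> \<D>} \<noteq> {}" using that by blast
    then obtain \<alpha> where "\<alpha> \<in> {\<alpha> \<in> under \<mu>. G \<alpha> \<in> \<D>}"
      "\<And>\<beta>. \<beta> \<in> {\<alpha> \<in> under \<mu>. G \<alpha> \<in> \<D>} \<Longrightarrow> \<alpha> \<in> under \<beta>"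
      using well_order_least[OF r, of "{\<alpha> \<in> under \<mu>. G \<alpha> \<in> \<D>}"] by blast
    then show ?thesis by blast
  qed
  have inter: "\<Inter>\<D> \<in> \<D>" if D: "\<D> \<subseteq> G ` under \<mu>" "\<D> \<noteq> {}" for \<D>
  proof -
    obtain \<alpha> where a: "\<alpha> \<in> under \<mu>" "G \<alpha> \<in> \<D>" "\<And>\<beta>. \<beta> \<in> under \<mu> \<Longrightarrow> G \<beta> \<in> \<D> \<Longrightarrow> \<alpha> \<in> under \<beta>"
      using least[OF D] by blast
    have "G \<alpha> \<subseteq> \<Inter>\<D>"
    proof (rule Inter_greatest)
      fix Y assume Y: "Y \<in> \<D>"
      then obtain \<beta> where b: "\<beta> \<in> under \<mu>" "Y = G \<beta>" using D by blast
      show "G \<alpha> \<subseteq> Y" using mono[OF b(1) a(3)[OF b(1)]] Y b(2) by simp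
    qed
    then have "\<Inter>\<D> = G \<alpha>" using a by blast
    then show ?thesis using a by simp
  qed
  have step: "C \<subseteq> \<Union>{D \<in> G ` under \<mu>. D \<subset> C} \<or>
      (\<exists>K\<in>G ` under \<mu>. K \<subset> C \<and> (\<forall>D\<in>G ` under \<mu>. D \<subset> C \<longrightarrow> D \<subseteq> K) \<and> \<Phi> K C)"
    if C: "C \<in> G ` under \<mu>" "C \<noteq> A" for C
  proof -
    \<comment> \<open>Taking the least index of \<open>C\<close> makes all earlier values strictly
      smaller. At a successor this excludes the equality alternative; at a limit it exhibits
      \<open>C\<close> as a union of smaller members.\<close>
    obtain \<nu> where n: "\<nu> \<in> under \<mu>" "G \<nu> = C" "\<And>\<beta>. \<beta> \<in> under \<mu> \<Longrightarrow> G \<beta> = C \<Longrightarrow> \<nu> \<in> under \<beta>"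
      using least[of "{C}"] C by auto
    have below: "G \<alpha> \<subset> C" "\<alpha> \<in> under \<mu>" if "\<alpha> \<in> underS \<nu>" for \<alpha>
    proof -
      show *: "\<alpha> \<in> under \<mu>" using under_trans[OF r underS_under[OF that] n(1)] .
      have "\<nu> \<notin> under \<alpha>" using that ANTISYM by (auto simp: underS_def under_def antisym_def)
      then have "G \<alpha> \<noteq> C" using n(3) * by blast
      then show "G \<alpha> \<subset> C" using mono[OF n(1) underS_under[OF that]] n(2) by blast
    qed
    have "\<nu> \<in> Field r" using n(1) by (auto simp: under_def Field_def)
    then show ?thesis
    proof (cases \<nu> rule: ord_cases)
      case zero
      then show ?thesis using assms(4)[OF n(1)] n(2) C by simp
    next
      case limit
      then have "C \<subseteq> (\<Union>\<alpha>\<in>underS \<nu>. G \<alpha>)" using assms(6)[OF n(1)] n(2) by simp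
      also have "\<dots> \<subseteq> \<Union>{D \<in> G ` under \<mu>. D \<subset> C}"
        using below by (intro UN_least Union_upper) simp
      finally show ?thesis by (rule disjI1)
    next
      case s: (suc \<alpha>)
      have au: "\<alpha> \<in> underS \<mu>" using underS_under_trans[OF r s(1) n(1)] .
      have "\<Phi> (G \<alpha>) C" using suc[OF au] below(1)[OF s(1)] s(2) n(2) by auto
      moreover have "D \<subseteq> G \<alpha>" if "D \<in> G ` under \<mu>" "D \<subset> C" for D
      proof -
        obtain \<gamma> where g: "\<gamma> \<in> under \<mu>" "D = G \<gamma>" using \<open>D \<in> G ` under \<mu>\<close> by blast
        have "\<nu> \<notin> under \<gamma>" using mono[OF g(1)] g that n by blast
        then have "\<gamma> \<in> underS \<nu>" using well_order_linear[OF r n(1) g(1)] by blast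
        then have "\<gamma> \<in> under \<alpha>" using suc_ord(3)[OF r au] s(2) by blast
        then show ?thesis using mono[OF below(2)[OF s(1)]] g by blast
      qed
      ultimately show ?thesis using below[OF s(1)] by blast
    qed
  qed
  have "A \<subseteq> C \<and> C \<subseteq> G \<mu>" if C: "C \<in> G ` under \<mu>" for C
  proof -
    obtain \<beta> where b: "\<beta> \<in> under \<mu>" "C = G \<beta>" using C by blast
    show ?thesis using mono[OF b(1) z(2)[OF b(1)]] mono[OF refl b(1)] Gz b(2) by simp
  qed
  moreover have "A \<in> G ` under \<mu>" using Gz z(1) by blast
  moreover have "G \<mu> \<in> G ` under \<mu>" using refl by blast
  ultimately show ?thesis
    unfolding well_chain_def using inter step by simp
qed

text \<open>Each member serves as its own index: the well-order is inclusion on \<open>\<C>\<close>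
  and the filtration is the identity. The index type is then \<open>'b set\<close>, the one over
  which \<open>in_Filt\<close> quantifies. The second conclusion makes a submodule occur in the
  filtration as soon as it belongs to \<open>\<C>\<close>.\<close>

lemma well_chain_X_filtration:
  fixes M :: "('a, 'b) module" and R :: "('a, 'r) ring_scheme"
  defines "s \<C> \<equiv> {(A, B). A \<in> \<C> \<and> B \<in> \<C> \<and> A \<subseteq> (B :: 'b set)}"
  assumes \<C>: "well_chain \<Phi> {\<zero>\<^bsub>M\<^esub>} (carrier M) \<C>"
    and sub: "\<And>C. C \<in> \<C> \<Longrightarrow> submodule C R M"
    and factor: "\<And>K H. K \<in> \<C> \<Longrightarrow> H \<in> \<C> \<Longrightarrow> K \<subset> H \<Longrightarrow> \<Phi> K H \<Longrightarrow>
      \<exists>X\<in>\<X>. lmod_iso R (quot_module (M\<lparr>carrier := H\<rparr>) K) X"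
  shows "X_filtration R \<X> M (s \<C>) (carrier M) (\<lambda>C. C)"
    and "under (s \<C>) (carrier M) = \<C>"
proof -
  let ?r = "s \<C>"
  have bot: "{\<zero>\<^bsub>M\<^esub>} \<in> \<C>" and top: "carrier M \<in> \<C>"
    and bd: "\<And>C. C \<in> \<C> \<Longrightarrow> {\<zero>\<^bsub>M\<^esub>} \<subseteq> C \<and> C \<subseteq> carrier M"
    and least: "\<And>\<D>. \<D> \<subseteq> \<C> \<Longrightarrow> \<D> \<noteq> {} \<Longrightarrow> \<Inter>\<D> \<in> \<D>"
    and step: "\<And>C. C \<in> \<C> \<Longrightarrow> C \<noteq> {\<zero>\<^bsub>M\<^esub>} \<Longrightarrow> C \<subseteq> \<Union>{D \<in> \<C>. D \<subset> C} \<or>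
      (\<exists>K\<in>\<C>. K \<subset> C \<and> (\<forall>D\<in>\<C>. D \<subset> C \<longrightarrow> D \<subseteq> K) \<and> \<Phi> K C)"
    using well_chainD[OF \<C>] by simp_all
  have mem: "(A, B) \<in> ?r \<longleftrightarrow> A \<in> \<C> \<and> B \<in> \<C> \<and> A \<subseteq> B" for A B by (simp add: s_def)
  have fld: "Field ?r = \<C>" by (auto simp: Field_def mem)
  have und: "under ?r C = {D \<in> \<C>. D \<subseteq> C}" if "C \<in> \<C>" for C
    using that by (auto simp: under_def mem)
  have undS: "underS ?r C = {D \<in> \<C>. D \<subset> C}" if "C \<in> \<C>" for C
    using that by (auto simp: underS_def mem)
  have total: "A \<subseteq> B \<or> B \<subseteq> A" if "A \<in> \<C>" "B \<in> \<C>" for A B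
    using least[of "{A, B}"] that by auto
  have lin: "Linear_order ?r"
    unfolding order_on_defs fld using total
    by (auto simp: mem refl_on_def trans_def antisym_def total_on_def)
  have wo: "Well_order ?r"
  proof -
    have "\<exists>a\<in>\<D>. \<forall>b\<in>\<D>. (a, b) \<in> ?r" if "\<D> \<subseteq> \<C>" "\<D> \<noteq> {}" for \<D>
      using least[OF that] that by (intro bexI[of _ "\<Inter>\<D>"]) (auto simp: mem)
    then show ?thesis using Linear_order_Well_order_iff[OF lin] fld by simp
  qed
  interpret wo_rel ?r using wo by (simp add: wo_rel_def)
  have suc_eq: "suc {K} = C"
    if "K \<in> \<C>" "C \<in> \<C>" "K \<subset> C" "\<And>D. D \<in> \<C> \<Longrightarrow> D \<subset> C \<Longrightarrow> D \<subseteq> K" for K C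
  proof -
    have "C \<in> AboveS {K}" using that by (auto simp: AboveS_def mem fld)
    moreover have "(C, D) \<in> ?r" if "D \<in> AboveS {K}" for D
    proof -
      have D: "D \<in> \<C>" "K \<subset> D" using that by (auto simp: AboveS_def mem fld)
      then have "\<not> D \<subset> C" using \<open>\<And>D. D \<in> \<C> \<Longrightarrow> D \<subset> C \<Longrightarrow> D \<subseteq> K\<close> by blast
      then show ?thesis using total[OF D(1) \<open>C \<in> \<C>\<close>] D \<open>C \<in> \<C>\<close> by (auto simp: mem)
    qed
    ultimately show ?thesis using equals_suc_AboveS[of "{K}" C] that fld by auto
  qed
  show u: "under (carrier M) = \<C>" using und[OF top] bd by blast
  have lim: "C = \<Union>(underS C)" if C: "C \<in> \<C>" "is_limit_ord ?r C" for C
  proof -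
    have "C \<noteq> {\<zero>\<^bsub>M\<^esub>}"
      using C bd undS[OF C(1)] by (auto simp: is_limit_ord_def)
    \<comment> \<open>An immediate predecessor would make \<open>C\<close> a successor.\<close>
    moreover have "\<not> (\<exists>K\<in>\<C>. K \<subset> C \<and> (\<forall>D\<in>\<C>. D \<subset> C \<longrightarrow> D \<subseteq> K) \<and> \<Phi> K C)"
    proof (rule notI, elim bexE conjE)
      fix K assume K: "K \<in> \<C>" "K \<subset> C" "\<forall>D\<in>\<C>. D \<subset> C \<longrightarrow> D \<subseteq> K"
      have "suc {K} = C" using suc_eq[OF K(1) C(1) K(2)] K(3) by simp
      moreover have "K \<in> underS C" using K undS[OF C(1)] by simp
      ultimately show False using C(2) unfolding is_limit_ord_def by blast
    qed
    ultimately have "C \<subseteq> \<Union>{D \<in> \<C>. D \<subset> C}" using step[OF C(1)] by blast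
    then show ?thesis unfolding undS[OF C(1)] by blast
  qed
  have zero: "C = {\<zero>\<^bsub>M\<^esub>}" if "C \<in> \<C>" "is_zero_ord ?r C" for C
    using that bot bd[of C] undS[of C] by (auto simp: is_zero_ord_def)
  show "X_filtration R \<X> M ?r (carrier M) (\<lambda>C. C)"
    unfolding X_filtration_def filtration_def u
  proof (intro conjI ballI impI)
    fix K assume "K \<in> underS (carrier M)"
    then have K: "K \<in> underS (carrier M)" "K \<in> \<C>" using undS[OF top] by auto
    let ?H = "suc {K}"
    have H: "?H \<in> \<C>" using suc_ord(2)[OF wo K(1)] u by blast
    have KH: "K \<subset> ?H" using suc_ord(1)[OF wo K(1)] undS[OF H] by blast
    have mx: "D \<subseteq> K" if "D \<in> \<C>" "D \<subset> ?H" for D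
      using suc_ord(3)[OF wo K(1)] undS[OF H] und[OF K(2)] that by blast
    have "?H \<noteq> {\<zero>\<^bsub>M\<^esub>}" using KH bd[OF K(2)] by blast
    moreover have "\<not> ?H \<subseteq> \<Union>{D \<in> \<C>. D \<subset> ?H}" using mx KH by blast
    ultimately obtain K' where K': "K' \<in> \<C>" "K' \<subset> ?H" "\<forall>D\<in>\<C>. D \<subset> ?H \<longrightarrow> D \<subseteq> K'" "\<Phi> K' ?H"
      using step[OF H] by blast
    \<comment> \<open>Both are the largest member strictly below \<open>?H\<close>: \<open>K\<close>
      by the description of successors, \<open>K'\<close> by the chain condition.\<close>
    then have "K' = K" using mx KH K by blast
    then show "\<exists>X\<in>\<X>. lmod_iso R (quot_module (M\<lparr>carrier := ?H\<rparr>) K) X"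
      using factor[OF K(2) H KH] K'(4) by simp
  next
    show "\<And>\<alpha> \<beta>. \<beta> \<in> \<C> \<Longrightarrow> \<alpha> \<in> under \<beta> \<Longrightarrow> \<alpha> \<subseteq> \<beta>" using und by blast
  next
    show "\<And>C. C \<in> \<C> \<Longrightarrow> is_limit_ord ?r C \<Longrightarrow> C = (\<Union>D\<in>underS C. D)"
      using lim by simp
    show "Well_order ?r" by (rule wo)
    show "carrier M \<in> Field ?r" using top fld by simp
    show "\<And>C. C \<in> \<C> \<Longrightarrow> is_zero_ord ?r C \<Longrightarrow> C = {\<zero>\<^bsub>M\<^esub>}" by (rule zero)
    show "\<And>C. C \<in> \<C> \<Longrightarrow> submodule C R M" by (rule sub)
  qed simp
qed

section \<open>Submodules and homomorphisms\<close>


context abelian_group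
begin

lemma add_minus_cancel_left: "x \<in> carrier G \<Longrightarrow> y \<in> carrier G \<Longrightarrow> x \<oplus> y \<ominus> x = y"
  by (simp add: a_minus_def a_comm[of x y] a_assoc r_neg)

lemma add_minus_cancel: "x \<in> carrier G \<Longrightarrow> y \<in> carrier G \<Longrightarrow> y \<oplus> (x \<ominus> y) = x"
  by (simp add: a_minus_def a_lcomm[of y x] r_neg)

lemma minus_eq_zeroD:
  assumes "x \<in> carrier G" "y \<in> carrier G" "x \<ominus> y = \<zero>"
  shows "x = y"
  using add_minus_cancel[OF assms(1,2)] assms by simp

end

section \<open>Submodules, their sums and directed unions\<close>

context left_module
begin

lemma smult_l_null: "x \<in> carrier M \<Longrightarrow> \<zero> \<odot>\<^bsub>M\<^esub> x = \<zero>\<^bsub>M\<^esub>"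
proof -
  assume x: "x \<in> carrier M"
  have "\<zero> \<odot>\<^bsub>M\<^esub> x \<oplus>\<^bsub>M\<^esub> \<zero> \<odot>\<^bsub>M\<^esub> x = \<zero> \<odot>\<^bsub>M\<^esub> x"
    using smult_l_distr[of \<zero> \<zero> x] x by simp
  then show ?thesis using x M.add.r_cancel_one by simp
qed

lemma smult_minus_one: "x \<in> carrier M \<Longrightarrow> (\<ominus> \<one>) \<odot>\<^bsub>M\<^esub> x = \<ominus>\<^bsub>M\<^esub> x"
proof -
  assume x: "x \<in> carrier M"
  have "(\<ominus> \<one>) \<odot>\<^bsub>M\<^esub> x \<oplus>\<^bsub>M\<^esub> x = (\<ominus> \<one> \<oplus> \<one>) \<odot>\<^bsub>M\<^esub> x"
    using smult_l_distr[of "\<ominus> \<one>" \<one> x] x by simp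
  also have "\<dots> = \<zero>\<^bsub>M\<^esub>" using x by (simp add: R.l_neg smult_l_null)
  finally show ?thesis using x by (intro M.minus_equality[symmetric]) auto
qed

lemma smult_r_null: "a \<in> carrier R \<Longrightarrow> a \<odot>\<^bsub>M\<^esub> \<zero>\<^bsub>M\<^esub> = \<zero>\<^bsub>M\<^esub>"
proof -
  assume a: "a \<in> carrier R"
  have "a \<odot>\<^bsub>M\<^esub> \<zero>\<^bsub>M\<^esub> \<oplus>\<^bsub>M\<^esub> a \<odot>\<^bsub>M\<^esub> \<zero>\<^bsub>M\<^esub> = a \<odot>\<^bsub>M\<^esub> \<zero>\<^bsub>M\<^esub>"
    using smult_r_distr[of a "\<zero>\<^bsub>M\<^esub>" "\<zero>\<^bsub>M\<^esub>"] a by simp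
  then show ?thesis using a M.add.r_cancel_one by simp
qed

lemma smult_r_minus:
  assumes "a \<in> carrier R" "x \<in> carrier M" "y \<in> carrier M"
  shows "a \<odot>\<^bsub>M\<^esub> (x \<ominus>\<^bsub>M\<^esub> y) = a \<odot>\<^bsub>M\<^esub> x \<ominus>\<^bsub>M\<^esub> a \<odot>\<^bsub>M\<^esub> y"
proof -
  have "a \<odot>\<^bsub>M\<^esub> (\<ominus>\<^bsub>M\<^esub> y) \<oplus>\<^bsub>M\<^esub> a \<odot>\<^bsub>M\<^esub> y = \<zero>\<^bsub>M\<^esub>"
    using smult_r_distr[of a "\<ominus>\<^bsub>M\<^esub> y" y] assms by (simp add: M.l_neg smult_r_null)
  then have "\<ominus>\<^bsub>M\<^esub> (a \<odot>\<^bsub>M\<^esub> y) = a \<odot>\<^bsub>M\<^esub> (\<ominus>\<^bsub>M\<^esub> y)"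
    using assms by (intro M.minus_equality) auto
  then show ?thesis using assms by (simp add: a_minus_def smult_r_distr)
qed

text \<open>Closure under negation comes for free, since -x is the multiple of x by -1.\<close>

lemma submoduleI:
  assumes "H \<subseteq> carrier M" "\<zero>\<^bsub>M\<^esub> \<in> H"
    and "\<And>x y. x \<in> H \<Longrightarrow> y \<in> H \<Longrightarrow> x \<oplus>\<^bsub>M\<^esub> y \<in> H"
    and smult: "\<And>a x. a \<in> carrier R \<Longrightarrow> x \<in> H \<Longrightarrow> a \<odot>\<^bsub>M\<^esub> x \<in> H"
  shows "submodule H R M"
proof -
  have "\<ominus>\<^bsub>M\<^esub> x \<in> H" if "x \<in> H" for x
    using smult[of "\<ominus> \<one>" x] that smult_minus_one[of x] assms(1) by auto
  then show ?thesis
    using assms by (auto intro!: submodule.intro subgroup.intro simp: submodule_axioms_def a_inv_def)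
qed

lemma submoduleE:
  assumes "submodule H R M"
  shows "H \<subseteq> carrier M" and "\<zero>\<^bsub>M\<^esub> \<in> H"
    and "\<And>x y. x \<in> H \<Longrightarrow> y \<in> H \<Longrightarrow> x \<oplus>\<^bsub>M\<^esub> y \<in> H"
    and "\<And>a x. a \<in> carrier R \<Longrightarrow> x \<in> H \<Longrightarrow> a \<odot>\<^bsub>M\<^esub> x \<in> H"
    and "\<And>x. x \<in> H \<Longrightarrow> \<ominus>\<^bsub>M\<^esub> x \<in> H"
    and "\<And>x y. x \<in> H \<Longrightarrow> y \<in> H \<Longrightarrow> x \<ominus>\<^bsub>M\<^esub> y \<in> H"
proof -
  interpret submodule H R M by fact
  show "H \<subseteq> carrier M" "\<zero>\<^bsub>M\<^esub> \<in> H" "\<And>x y. x \<in> H \<Longrightarrow> y \<in> H \<Longrightarrow> x \<oplus>\<^bsub>M\<^esub> y \<in> H"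
    "\<And>a x. a \<in> carrier R \<Longrightarrow> x \<in> H \<Longrightarrow> a \<odot>\<^bsub>M\<^esub> x \<in> H"
    using subset one_closed m_closed by auto
  show m: "\<ominus>\<^bsub>M\<^esub> x \<in> H" if "x \<in> H" for x using m_inv_closed[OF that] by (simp add: a_inv_def)
  show "x \<ominus>\<^bsub>M\<^esub> y \<in> H" if "x \<in> H" "y \<in> H" for x y
    using m_closed[of x "\<ominus>\<^bsub>M\<^esub> y"] m that by (simp add: a_minus_def)
qed

lemma carrier_is_submodule: "submodule (carrier M) R M"
  by (rule submoduleI) auto

lemma zero_is_submodule: "submodule {\<zero>\<^bsub>M\<^esub>} R M"
  by (rule submoduleI) (auto simp: smult_r_null)

lemma submodule_is_left_module:
  assumes "submodule H R M"
  shows "left_module R (M\<lparr>carrier := H\<rparr>)"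
proof -
  note H = submoduleE[OF assms]
  have c: "x \<in> carrier M" if "x \<in> H" for x using H(1) that by blast
  have "abelian_group (M\<lparr>carrier := H\<rparr>)"
  proof (rule abelian_groupI)
    fix x assume x: "x \<in> carrier (M\<lparr>carrier := H\<rparr>)"
    then have "\<ominus>\<^bsub>M\<^esub> x \<in> H" "\<ominus>\<^bsub>M\<^esub> x \<oplus>\<^bsub>M\<^esub> x = \<zero>\<^bsub>M\<^esub>"
      using H(5) M.l_neg c by simp_all
    then show "\<exists>y\<in>carrier (M\<lparr>carrier := H\<rparr>). y \<oplus>\<^bsub>M\<lparr>carrier := H\<rparr>\<^esub> x = \<zero>\<^bsub>M\<lparr>carrier := H\<rparr>\<^esub>"
      by auto
  qed (simp_all add: H c M.a_ac)
  then show ?thesis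
    by (intro left_module.intro left_module_axioms.intro R.ring_axioms)
      (simp_all add: H c smult_l_distr smult_r_distr smult_assoc1)
qed

lemma submodule_of_submodule:
  assumes "submodule H R M" "submodule K R M" "K \<subseteq> H"
  shows "submodule K R (M\<lparr>carrier := H\<rparr>)"
  using assms(3) submoduleE(2-4)[OF assms(2)]
  by (intro left_module.submoduleI[OF submodule_is_left_module[OF assms(1)]]) simp_all

lemma submodule_Inter:
  assumes "\<H> \<noteq> {}" "\<And>H. H \<in> \<H> \<Longrightarrow> submodule H R M"
  shows "submodule (\<Inter>\<H>) R M"
proof (rule submoduleI)
  show "\<Inter>\<H> \<subseteq> carrier M" using assms submoduleE(1) by blast
qed (use assms(2) submoduleE(2-4) in auto)

lemma submodule_directed_Union:
  assumes "I \<noteq> {}" "\<And>i. i \<in> I \<Longrightarrow> submodule (H i) R M"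
    and "\<And>i j. i \<in> I \<Longrightarrow> j \<in> I \<Longrightarrow> H i \<subseteq> H j \<or> H j \<subseteq> H i"
  shows "submodule (\<Union>i\<in>I. H i) R M"
proof (rule submoduleI)
  show "(\<Union>i\<in>I. H i) \<subseteq> carrier M" using assms(2) submoduleE(1) by blast
  show "\<zero>\<^bsub>M\<^esub> \<in> (\<Union>i\<in>I. H i)" using assms(1,2) submoduleE(2) by blast
  show "a \<odot>\<^bsub>M\<^esub> x \<in> (\<Union>i\<in>I. H i)" if "a \<in> carrier R" "x \<in> (\<Union>i\<in>I. H i)" for a x
    using that assms(2) submoduleE(4) by blast
  show "x \<oplus>\<^bsub>M\<^esub> y \<in> (\<Union>i\<in>I. H i)" if xy: "x \<in> (\<Union>i\<in>I. H i)" "y \<in> (\<Union>i\<in>I. H i)" for x y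
  proof -
    obtain i j where "i \<in> I" "j \<in> I" "x \<in> H i" "y \<in> H j" using xy by blast
    moreover obtain k where "k \<in> I" "x \<in> H k" "y \<in> H k"
      using assms(3)[of i j] calculation by blast
    ultimately show ?thesis using submoduleE(3)[OF assms(2)] by blast
  qed
qed

lemma set_add_iff: "x \<in> H <+>\<^bsub>M\<^esub> K \<longleftrightarrow> (\<exists>h\<in>H. \<exists>k\<in>K. x = h \<oplus>\<^bsub>M\<^esub> k)"
  by (auto simp: set_add_def')

lemma submodule_set_add:
  assumes H: "submodule H R M" and K: "submodule K R M"
  shows "submodule (H <+>\<^bsub>M\<^esub> K) R M" and "H \<subseteq> H <+>\<^bsub>M\<^esub> K" and "K \<subseteq> H <+>\<^bsub>M\<^esub> K"
    and "\<And>L. submodule L R M \<Longrightarrow> H \<subseteq> L \<Longrightarrow> K \<subseteq> L \<Longrightarrow> H <+>\<^bsub>M\<^esub> K \<subseteq> L"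
proof -
  note h = submoduleE[OF H] and k = submoduleE[OF K]
  have hc: "x \<in> carrier M" if "x \<in> H" for x using h(1) that by blast
  have kc: "x \<in> carrier M" if "x \<in> K" for x using k(1) that by blast
  show "submodule (H <+>\<^bsub>M\<^esub> K) R M"
  proof (rule submoduleI)
    show "H <+>\<^bsub>M\<^esub> K \<subseteq> carrier M" by (auto simp: set_add_iff hc kc)
    show "\<zero>\<^bsub>M\<^esub> \<in> H <+>\<^bsub>M\<^esub> K"
      unfolding set_add_iff using h(2) k(2) by (intro bexI[of _ "\<zero>\<^bsub>M\<^esub>"]) auto
    show "a \<odot>\<^bsub>M\<^esub> x \<in> H <+>\<^bsub>M\<^esub> K" if a: "a \<in> carrier R" and x: "x \<in> H <+>\<^bsub>M\<^esub> K" for a x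
    proof -
      obtain u v where "u \<in> H" "v \<in> K" "x = u \<oplus>\<^bsub>M\<^esub> v" using x unfolding set_add_iff by blast
      then show ?thesis unfolding set_add_iff
        using h(4)[OF a] k(4)[OF a] smult_r_distr[OF a hc kc] by metis
    qed
    show "x \<oplus>\<^bsub>M\<^esub> y \<in> H <+>\<^bsub>M\<^esub> K" if x: "x \<in> H <+>\<^bsub>M\<^esub> K" and y: "y \<in> H <+>\<^bsub>M\<^esub> K" for x y
    proof -
      obtain u v where u: "u \<in> H" "v \<in> K" "x = u \<oplus>\<^bsub>M\<^esub> v" using x unfolding set_add_iff by blast
      obtain u' v' where u': "u' \<in> H" "v' \<in> K" "y = u' \<oplus>\<^bsub>M\<^esub> v'" using y unfolding set_add_iff by blast
      have "x \<oplus>\<^bsub>M\<^esub> y = (u \<oplus>\<^bsub>M\<^esub> u') \<oplus>\<^bsub>M\<^esub> (v \<oplus>\<^bsub>M\<^esub> v')"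
        using u u' hc kc by (simp add: M.a_ac)
      then show ?thesis unfolding set_add_iff using h(3) k(3) u u' by blast
    qed
  qed
  show "H \<subseteq> H <+>\<^bsub>M\<^esub> K"
  proof
    fix x assume "x \<in> H"
    then show "x \<in> H <+>\<^bsub>M\<^esub> K"
      unfolding set_add_iff using k(2) hc by (intro bexI[of _ x] bexI[of _ "\<zero>\<^bsub>M\<^esub>"]) auto
  qed
  show "K \<subseteq> H <+>\<^bsub>M\<^esub> K"
  proof
    fix x assume "x \<in> K"
    then show "x \<in> H <+>\<^bsub>M\<^esub> K"
      unfolding set_add_iff using h(2) kc by (intro bexI[of _ x] bexI[of _ "\<zero>\<^bsub>M\<^esub>"]) auto
  qed
  show "H <+>\<^bsub>M\<^esub> K \<subseteq> L" if L: "submodule L R M" "H \<subseteq> L" "K \<subseteq> L" for L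
    using submoduleE(3)[OF L(1)] L(2,3) by (auto simp: set_add_iff subset_iff)
qed

end

text \<open>\<open>S \<subseteq> carrier M\<close> puts the whole module among the submodules that
  are intersected; an empty family would give the universal set.\<close>

lemma gen_submodule:
  assumes "left_module R M" and S: "S \<subseteq> carrier M"
  shows "submodule (gen_submodule R M S) R M" and "S \<subseteq> gen_submodule R M S"
    and "\<And>H. submodule H R M \<Longrightarrow> S \<subseteq> H \<Longrightarrow> gen_submodule R M S \<subseteq> H"
proof -
  interpret left_module R M by fact
  show "submodule (gen_submodule R M S) R M"
    unfolding gen_submodule_def using carrier_is_submodule S by (intro submodule_Inter) blast+
  show "S \<subseteq> gen_submodule R M S" by (auto simp: gen_submodule_def)
  show "\<And>H. submodule H R M \<Longrightarrow> S \<subseteq> H \<Longrightarrow> gen_submodule R M S \<subseteq> H"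
    by (auto simp: gen_submodule_def)
qed

section \<open>Homomorphisms, and what bricks imply about them\<close>

lemma lmod_homD:
  assumes "f \<in> lmod_hom R M N"
  shows "\<And>x. x \<in> carrier M \<Longrightarrow> f x \<in> carrier N"
    and "\<And>x y. x \<in> carrier M \<Longrightarrow> y \<in> carrier M \<Longrightarrow> f (x \<oplus>\<^bsub>M\<^esub> y) = f x \<oplus>\<^bsub>N\<^esub> f y"
    and "\<And>a x. a \<in> carrier R \<Longrightarrow> x \<in> carrier M \<Longrightarrow> f (a \<odot>\<^bsub>M\<^esub> x) = a \<odot>\<^bsub>N\<^esub> f x"
  using assms by (auto simp: lmod_hom_def)

text \<open>Homomorphisms are extensional, so a map given by a formula has to be cut off outside the
  carrier; this rule leaves only the algebraic conditions.\<close>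

lemma restrict_lmod_homI:
  assumes "left_module R M"
    and "\<And>x. x \<in> carrier M \<Longrightarrow> f x \<in> carrier N"
    and "\<And>x y. x \<in> carrier M \<Longrightarrow> y \<in> carrier M \<Longrightarrow> f (x \<oplus>\<^bsub>M\<^esub> y) = f x \<oplus>\<^bsub>N\<^esub> f y"
    and "\<And>a x. a \<in> carrier R \<Longrightarrow> x \<in> carrier M \<Longrightarrow> f (a \<odot>\<^bsub>M\<^esub> x) = a \<odot>\<^bsub>N\<^esub> f x"
  shows "restrict f (carrier M) \<in> lmod_hom R M N"
proof -
  interpret left_module R M by fact
  show ?thesis using assms(2-4) by (auto simp: lmod_hom_def)
qed

lemma compose_lmod_hom:
  assumes "left_module R M" "f \<in> lmod_hom R M N" "g \<in> lmod_hom R N L"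
  shows "compose (carrier M) g f \<in> lmod_hom R M L"
  unfolding compose_def
  using lmod_homD[OF assms(2)] lmod_homD[OF assms(3)] by (intro restrict_lmod_homI[OF assms(1)]) auto

lemma lmod_hom_zero:
  assumes "left_module R M" "left_module R N" "f \<in> lmod_hom R M N"
  shows "f \<zero>\<^bsub>M\<^esub> = \<zero>\<^bsub>N\<^esub>"
proof -
  interpret M: left_module R M by fact
  interpret N: left_module R N by fact
  have "f \<zero>\<^bsub>M\<^esub> = f (\<zero>\<^bsub>R\<^esub> \<odot>\<^bsub>M\<^esub> \<zero>\<^bsub>M\<^esub>)" by (simp add: M.smult_l_null)
  also have "\<dots> = \<zero>\<^bsub>N\<^esub>" using lmod_homD[OF assms(3)] N.smult_l_null by simp
  finally show ?thesis .
qed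

lemma lmod_hom_minus:
  assumes "left_module R M" "left_module R N" "f \<in> lmod_hom R M N"
    and "x \<in> carrier M" "y \<in> carrier M"
  shows "f (x \<ominus>\<^bsub>M\<^esub> y) = f x \<ominus>\<^bsub>N\<^esub> f y"
proof -
  interpret M: left_module R M by fact
  interpret N: left_module R N by fact
  have "f (\<ominus>\<^bsub>M\<^esub> y) = \<ominus>\<^bsub>N\<^esub> f y"
    using lmod_homD(1)[OF assms(3) assms(5)] lmod_homD(3)[OF assms(3), of "\<ominus>\<^bsub>R\<^esub> \<one>\<^bsub>R\<^esub>" y] assms(5)
    by (simp add: M.smult_minus_one N.smult_minus_one)
  then show ?thesis using lmod_homD(2)[OF assms(3)] assms(4,5) by (simp add: a_minus_def)
qed

lemma lmod_hom_vimage_submodule: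
  assumes "left_module R M" "left_module R N" "f \<in> lmod_hom R M N" "submodule H R N"
  shows "submodule {x \<in> carrier M. f x \<in> H} R M"
proof -
  interpret M: left_module R M by fact
  interpret N: left_module R N by fact
  show ?thesis
    using lmod_homD[OF assms(3)] N.submoduleE(2-4)[OF assms(4)] lmod_hom_zero[OF assms(1-3)]
    by (intro M.submoduleI) auto
qed

lemma lmod_hom_image_submodule:
  assumes "left_module R M" "left_module R N" "f \<in> lmod_hom R M N" "submodule H R M"
  shows "submodule (f ` H) R N"
proof -
  interpret M: left_module R M by fact
  interpret N: left_module R N by fact
  note f = lmod_homD[OF assms(3)] and H = M.submoduleE[OF assms(4)]
  have c: "x \<in> carrier M" if "x \<in> H" for x using that H(1) by blast
  show ?thesis
  proof (rule N.submoduleI)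
    show "f ` H \<subseteq> carrier N" using f(1) c by blast
    show "\<zero>\<^bsub>N\<^esub> \<in> f ` H" using lmod_hom_zero[OF assms(1-3)] H(2) by (metis imageI)
    show "x \<oplus>\<^bsub>N\<^esub> y \<in> f ` H" if xy: "x \<in> f ` H" "y \<in> f ` H" for x y
    proof -
      obtain u v where "u \<in> H" "v \<in> H" "x = f u" "y = f v" using xy by blast
      then have "x \<oplus>\<^bsub>N\<^esub> y = f (u \<oplus>\<^bsub>M\<^esub> v)" "u \<oplus>\<^bsub>M\<^esub> v \<in> H" using f(2) c H(3) by simp_all
      then show ?thesis by (rule image_eqI)
    qed
    show "a \<odot>\<^bsub>N\<^esub> x \<in> f ` H" if ax: "a \<in> carrier R" "x \<in> f ` H" for a x
    proof -
      obtain u where "u \<in> H" "x = f u" using ax by blast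
      then have "a \<odot>\<^bsub>N\<^esub> x = f (a \<odot>\<^bsub>M\<^esub> u)" "a \<odot>\<^bsub>M\<^esub> u \<in> H" using ax f(3) c H(4) by simp_all
      then show ?thesis by (rule image_eqI)
    qed
  qed
qed

lemma inv_lmod_hom:
  assumes "left_module R M" "left_module R N" "f \<in> lmod_hom R M N"
    and "bij_betw f (carrier M) (carrier N)"
  obtains g where "g \<in> lmod_hom R N M" "\<And>y. y \<in> carrier N \<Longrightarrow> f (g y) = y"
    "\<And>x. x \<in> carrier M \<Longrightarrow> g (f x) = x"
proof -
  interpret M: left_module R M by fact
  interpret N: left_module R N by fact
  note f = lmod_homD[OF assms(3)]
  let ?g = "inv_into (carrier M) f"
  have fg: "f (?g y) = y" "?g y \<in> carrier M" if "y \<in> carrier N" for y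
    using assms(4) that by (auto simp: bij_betw_def f_inv_into_f inv_into_into)
  have gf: "?g (f x) = x" if "x \<in> carrier M" for x
    using assms(4) that by (auto simp: bij_betw_def)
  have "restrict ?g (carrier N) \<in> lmod_hom R N M"
  proof (rule restrict_lmod_homI[OF assms(2)])
    show "?g (x \<oplus>\<^bsub>N\<^esub> y) = ?g x \<oplus>\<^bsub>M\<^esub> ?g y" if "x \<in> carrier N" "y \<in> carrier N" for x y
      using gf[of "?g x \<oplus>\<^bsub>M\<^esub> ?g y"] f(2)[of "?g x" "?g y"] fg that by simp
    show "?g (a \<odot>\<^bsub>N\<^esub> x) = a \<odot>\<^bsub>M\<^esub> ?g x" if "a \<in> carrier R" "x \<in> carrier N" for a x
      using gf[of "a \<odot>\<^bsub>M\<^esub> ?g x"] f(3)[of a "?g x"] fg that by simp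
  qed (use fg in auto)
  then show thesis using that[of "restrict ?g (carrier N)"] fg gf f(1) by simp
qed

lemma zero_hom_iff:
  assumes "f \<in> lmod_hom R M N"
  shows "f = zero_hom M N \<longleftrightarrow> (\<forall>x\<in>carrier M. f x = \<zero>\<^bsub>N\<^esub>)"
proof
  assume "\<forall>x\<in>carrier M. f x = \<zero>\<^bsub>N\<^esub>"
  then show "f = zero_hom M N"
    using assms by (intro ext) (auto simp: lmod_hom_def zero_hom_def PiE_def extensional_def)
qed (simp add: zero_hom_def)

lemma lmod_hom_codomain_submodule:
  assumes "f \<in> lmod_hom R M N" "f ` carrier M \<subseteq> H"
  shows "f \<in> lmod_hom R M (N\<lparr>carrier := H\<rparr>)"
  using assms by (auto simp: lmod_hom_def PiE_def Pi_def)

lemma lmod_hom_domain_submodule: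
  assumes "left_module R M" "f \<in> lmod_hom R M N" "submodule H R M"
  shows "restrict f H \<in> lmod_hom R (M\<lparr>carrier := H\<rparr>) N"
proof -
  interpret left_module R M by fact
  note H = submoduleE(1)[OF assms(3)]
  have "restrict f (carrier (M\<lparr>carrier := H\<rparr>)) \<in> lmod_hom R (M\<lparr>carrier := H\<rparr>) N"
    using lmod_homD[OF assms(2)] H
    by (intro restrict_lmod_homI submodule_is_left_module assms) (simp_all add: subset_iff)
  then show ?thesis by simp
qed

text \<open>A nonzero map rules out orthogonality, so X and Y are isomorphic, though possibly
  different, as a semibrick may contain several copies of a brick. Followed by an isomorphism back
  to X, the map becomes a nonzero element of a division ring of endomorphisms, hence
  invertible.\<close>

lemma semibrick_hom_bij:
  assumes sb: "semibrick R \<X>" and X: "X \<in> \<X>" and Y: "Y \<in> \<X>"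
    and f: "f \<in> lmod_hom R X Y" and nz: "f \<noteq> zero_hom X Y"
  shows "bij_betw f (carrier X) (carrier Y)"
proof -
  have bX: "left_module R X" "division_ring (End_ring R X)" and lY: "left_module R Y"
    using sb X Y by (auto simp: semibrick_def brick_def)
  interpret X: left_module R X by fact
  interpret Y: left_module R Y by fact
  have "lmod_iso R X Y"
    using sb X Y f nz by (force simp: semibrick_def orthogonal_bricks_def)
  then obtain i where i: "i \<in> lmod_hom R X Y" "bij_betw i (carrier X) (carrier Y)"
    by (auto simp: lmod_iso_def)
  obtain j where j: "j \<in> lmod_hom R Y X" "\<And>y. y \<in> carrier Y \<Longrightarrow> i (j y) = y"
    "\<And>x. x \<in> carrier X \<Longrightarrow> j (i x) = x"
    using inv_lmod_hom[OF bX(1) lY i] by blast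
  let ?e = "compose (carrier X) j f"
  have e: "?e \<in> lmod_hom R X X" using compose_lmod_hom[OF bX(1) f j(1)] .
  have "?e \<noteq> zero_hom X X"
  proof
    assume "?e = zero_hom X X"
    then have *: "\<forall>x\<in>carrier X. j (f x) = \<zero>\<^bsub>X\<^esub>" using zero_hom_iff[OF e] by (simp add: compose_eq)
    have "f x = \<zero>\<^bsub>Y\<^esub>" if "x \<in> carrier X" for x
      using *[rule_format, OF that] j(2)[of "f x"] lmod_homD(1)[OF f that]
        lmod_hom_zero[OF bX(1) lY i(1)] by simp
    then show False using nz zero_hom_iff[OF f] by blast
  qed
  then have "?e \<in> Units (End_ring R X)"
    using bX(2) e by (simp add: division_ring_def End_ring_def)
  then obtain d where d: "d \<in> lmod_hom R X X" "compose (carrier X) d ?e = (\<lambda>x\<in>carrier X. x)"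
    "compose (carrier X) ?e d = (\<lambda>x\<in>carrier X. x)"
    by (auto simp: Units_def End_ring_def)
  have de: "d (j (f x)) = x" if "x \<in> carrier X" for x
    using fun_cong[OF d(2), of x] that by (simp add: compose_eq)
  have ed: "j (f (d x)) = x" if "x \<in> carrier X" for x
    using fun_cong[OF d(3), of x] that lmod_homD(1)[OF d(1) that] by (simp add: compose_eq)
  \<comment> \<open>With \<open>d\<close> inverse to \<open>?e\<close>, the map \<open>d\<close>
    after \<open>j\<close> is inverse to \<open>f\<close>; that it is a right inverse follows by
    applying \<open>i\<close>, which cancels \<open>j\<close>.\<close>
  show ?thesis
  proof (rule bij_betw_byWitness[where f' = "\<lambda>y. d (j y)"])
    show "\<forall>y\<in>carrier Y. f (d (j y)) = y"
    proof
      fix y assume y: "y \<in> carrier Y"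
      have "i (j (f (d (j y)))) = i (j y)" using ed[OF lmod_homD(1)[OF j(1) y]] by simp
      then show "f (d (j y)) = y"
        using j(2)[OF y] j(2)[of "f (d (j y))"]
          lmod_homD(1)[OF f lmod_homD(1)[OF d(1) lmod_homD(1)[OF j(1) y]]] by simp
    qed
  qed (use de lmod_homD(1)[OF f] lmod_homD(1)[OF j(1)] lmod_homD(1)[OF d(1)] in auto)
qed

text \<open>The generators are the images of the standard basis vectors. Generation is phrased
  through the submodules that contain \<open>G\<close>, which suits the limit step: there the
  submodule is a preimage.\<close>

lemma finitely_presented_imp_finitely_generated:
  assumes X: "left_module R X" and fp: "finitely_presented R X"
  obtains G where "finite G" "G \<subseteq> carrier X"
    "\<And>H. submodule H R X \<Longrightarrow> G \<subseteq> H \<Longrightarrow> carrier X \<subseteq> H"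
proof -
  interpret X: left_module R X by fact
  obtain n f where f: "f \<in> lmod_hom R (free_lmod R n) X" "f ` carrier (free_lmod R n) = carrier X"
    using fp by (auto simp: finitely_presented_def)
  define e where "e i = (\<lambda>j\<in>{..<n}. if j = i then \<one>\<^bsub>R\<^esub> else \<zero>\<^bsub>R\<^esub>)" for i
  have e: "e i \<in> carrier (free_lmod R n)" for i
    by (auto simp: e_def free_lmod_def)
  have "carrier X \<subseteq> H" if H: "submodule H R X" and G: "(\<lambda>i. f (e i)) ` {..<n} \<subseteq> H" for H
  proof -
    note h = X.submoduleE[OF H]
    \<comment> \<open>Induction on the number k of leading coordinates that may be nonzero; k = n
      imposes no condition.\<close>
    have *: "f u \<in> H" if "k \<le> n" "u \<in> carrier (free_lmod R n)" "\<forall>i\<in>{k..<n}. u i = \<zero>\<^bsub>R\<^esub>" for k u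
      using that
    proof (induction k arbitrary: u)
      case 0
      \<comment> \<open>The vector is zero. Written as a multiple by 0, it is sent to 0 by
        linearity, without first proving the module laws for the free module.\<close>
      have "u = \<zero>\<^bsub>R\<^esub> \<odot>\<^bsub>free_lmod R n\<^esub> u"
        using 0 by (intro ext) (auto simp: free_lmod_def PiE_def extensional_def)
      then have "f u = \<zero>\<^bsub>R\<^esub> \<odot>\<^bsub>X\<^esub> f u"
        using lmod_homD(3)[OF f(1), of "\<zero>\<^bsub>R\<^esub>" u] 0(2) by simp
      then show ?case using X.smult_l_null lmod_homD(1)[OF f(1) 0(2)] h(2) by simp
    next
      case (Suc k)
      have u: "\<And>i. i < n \<Longrightarrow> u i \<in> carrier R" "\<And>i. \<not> i < n \<Longrightarrow> u i = undefined"
        using Suc(3) by (auto simp: free_lmod_def PiE_def extensional_def)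
      let ?v = "u(k := \<zero>\<^bsub>R\<^esub>)"
      let ?w = "u k \<odot>\<^bsub>free_lmod R n\<^esub> e k"
      have k: "k < n" using Suc by simp
      have v: "?v \<in> carrier (free_lmod R n)"
        using u k by (auto simp: free_lmod_def PiE_def extensional_def)
      have w: "?w \<in> carrier (free_lmod R n)"
        using u k by (auto simp: free_lmod_def e_def)
      \<comment> \<open>The k-th coordinate is split off as a multiple of the basis vector.\<close>
      have "u = ?v \<oplus>\<^bsub>free_lmod R n\<^esub> ?w"
        using u k by (intro ext) (auto simp: free_lmod_def e_def)
      then have "f u = f ?v \<oplus>\<^bsub>X\<^esub> f ?w" using lmod_homD(2)[OF f(1) v w] by simp
      moreover have "f ?v \<in> H"
      proof (rule Suc.IH)
        show "\<forall>i\<in>{k..<n}. ?v i = \<zero>\<^bsub>R\<^esub>" using Suc(4) by auto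
      qed (use Suc(2) in simp, rule v)
      moreover have "f ?w \<in> H"
      proof -
        have "f ?w = u k \<odot>\<^bsub>X\<^esub> f (e k)" using lmod_homD(3)[OF f(1) u(1)[OF k] e] .
        moreover have "f (e k) \<in> H" using G k by blast
        ultimately show ?thesis using h(4)[OF u(1)[OF k]] by simp
      qed
      ultimately show ?case using h(3) by simp
    qed
    have "f u \<in> H" if "u \<in> carrier (free_lmod R n)" for u using *[of n u] that by simp
    then show ?thesis unfolding f(2)[symmetric] by (rule image_subsetI)
  qed
  then show thesis
    using that[of "(\<lambda>i. f (e i)) ` {..<n}"] lmod_homD(1)[OF f(1) e] by (simp add: image_subset_iff)
qed

section \<open>Quotient modules and subfactors\<close>


context left_module
begin

lemma submodule_abelian_subgroup: "submodule K R M \<Longrightarrow> abelian_subgroup K M"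
  by (intro abelian_subgroupI3 additive_subgroup.intro M.abelian_group_axioms submodule.axioms(1))

lemma mem_coset_iff:
  assumes "submodule K R M" "x \<in> carrier M" "y \<in> carrier M"
  shows "y \<in> K +>\<^bsub>M\<^esub> x \<longleftrightarrow> y \<ominus>\<^bsub>M\<^esub> x \<in> K"
proof
  note K = submoduleE[OF assms(1)]
  assume "y \<in> K +>\<^bsub>M\<^esub> x"
  then obtain k where k: "k \<in> K" "y = k \<oplus>\<^bsub>M\<^esub> x" by (auto simp: a_r_coset_def')
  then have "y \<ominus>\<^bsub>M\<^esub> x = k"
    using K(1) assms(2) by (auto simp: a_minus_def M.a_assoc M.r_neg)
  then show "y \<ominus>\<^bsub>M\<^esub> x \<in> K" using k by simp
next
  assume "y \<ominus>\<^bsub>M\<^esub> x \<in> K"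
  moreover have "y = (y \<ominus>\<^bsub>M\<^esub> x) \<oplus>\<^bsub>M\<^esub> x"
    using assms(2,3) by (simp add: a_minus_def M.a_assoc M.l_neg)
  ultimately show "y \<in> K +>\<^bsub>M\<^esub> x" by (auto simp: a_r_coset_def')
qed

lemma self_mem_coset:
  assumes "submodule K R M" "x \<in> carrier M"
  shows "x \<in> K +>\<^bsub>M\<^esub> x"
  using mem_coset_iff[OF assms assms(2)] submoduleE(2)[OF assms(1)] assms(2)
  by (simp add: a_minus_def M.r_neg)

lemma coset_eq_iff:
  assumes "submodule K R M" "x \<in> carrier M" "y \<in> carrier M"
  shows "K +>\<^bsub>M\<^esub> x = K +>\<^bsub>M\<^esub> y \<longleftrightarrow> x \<ominus>\<^bsub>M\<^esub> y \<in> K"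
proof
  assume "K +>\<^bsub>M\<^esub> x = K +>\<^bsub>M\<^esub> y"
  then show "x \<ominus>\<^bsub>M\<^esub> y \<in> K"
    using self_mem_coset[OF assms(1,2)] mem_coset_iff[OF assms(1,3,2)] by simp
next
  assume "x \<ominus>\<^bsub>M\<^esub> y \<in> K"
  then have "x \<in> K +>\<^bsub>M\<^esub> y" using mem_coset_iff[OF assms(1,3,2)] by simp
  then show "K +>\<^bsub>M\<^esub> x = K +>\<^bsub>M\<^esub> y"
    using M.a_repr_independence[OF _ assms(3) submodule.axioms(1)[OF assms(1)]] by simp
qed

lemma coset_eq_self_iff:
  assumes "submodule K R M" "x \<in> carrier M"
  shows "K +>\<^bsub>M\<^esub> x = K \<longleftrightarrow> x \<in> K"
  using M.a_coset_join1[OF _ assms(2)] M.a_coset_join2[OF assms(2)] submodule.axioms(1)[OF assms(1)]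
  by blast

end

text \<open>Scalar multiplication is left out: its union formula collapses only on actual cosets,
  under the hypotheses of \<open>quot_module_smult\<close>.\<close>

lemma quot_module_sels [simp]:
  "carrier (quot_module M K) = (\<lambda>x. K +>\<^bsub>M\<^esub> x) ` carrier M"
  "zero (quot_module M K) = K"
  "A \<oplus>\<^bsub>quot_module M K\<^esub> B = A <+>\<^bsub>M\<^esub> B"
  by (auto simp: quot_module_def A_RCOSETS_def')

lemma quot_module_add:
  assumes "left_module R M" "submodule K R M" "x \<in> carrier M" "y \<in> carrier M"
  shows "(K +>\<^bsub>M\<^esub> x) <+>\<^bsub>M\<^esub> (K +>\<^bsub>M\<^esub> y) = K +>\<^bsub>M\<^esub> (x \<oplus>\<^bsub>M\<^esub> y)"
proof -
  interpret left_module R M by fact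
  interpret abelian_subgroup K M by (rule submodule_abelian_subgroup[OF assms(2)])
  show ?thesis using a_rcos_sum assms(3,4) by simp
qed

text \<open>The cosets of the elements ay, for y in the coset of x, all coincide, and a union of
  equal sets over a nonempty index set is that set.\<close>

lemma quot_module_smult:
  assumes "left_module R M" "submodule K R M" "a \<in> carrier R" "x \<in> carrier M"
  shows "a \<odot>\<^bsub>quot_module M K\<^esub> (K +>\<^bsub>M\<^esub> x) = K +>\<^bsub>M\<^esub> (a \<odot>\<^bsub>M\<^esub> x)"
proof -
  interpret left_module R M by fact
  note K = submoduleE[OF assms(2)]
  have *: "K +>\<^bsub>M\<^esub> (a \<odot>\<^bsub>M\<^esub> y) = K +>\<^bsub>M\<^esub> (a \<odot>\<^bsub>M\<^esub> x)" if y: "y \<in> K +>\<^bsub>M\<^esub> x" for y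
  proof -
    obtain k where k: "k \<in> K" "y = k \<oplus>\<^bsub>M\<^esub> x" using y by (auto simp: a_r_coset_def')
    have kc: "k \<in> carrier M" using k K(1) by blast
    have "a \<odot>\<^bsub>M\<^esub> y = a \<odot>\<^bsub>M\<^esub> k \<oplus>\<^bsub>M\<^esub> a \<odot>\<^bsub>M\<^esub> x"
      unfolding k(2) by (rule smult_r_distr[OF assms(3) kc assms(4)])
    then have "a \<odot>\<^bsub>M\<^esub> y \<in> K +>\<^bsub>M\<^esub> (a \<odot>\<^bsub>M\<^esub> x)"
      using K(4)[OF assms(3) k(1)] unfolding a_r_coset_def' by blast
    then show ?thesis
      using M.a_repr_independence[OF _ _ submodule.axioms(1)[OF assms(2)]] assms(3,4) by simp
  qed
  have "(\<Union>y\<in>K +>\<^bsub>M\<^esub> x. K +>\<^bsub>M\<^esub> (a \<odot>\<^bsub>M\<^esub> y)) = K +>\<^bsub>M\<^esub> (a \<odot>\<^bsub>M\<^esub> x)"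
    using * by (intro UN_constant_eq[OF self_mem_coset[OF assms(2,4)]]) blast
  then show ?thesis by (simp add: quot_module_def)
qed

lemma left_module_quot_module:
  assumes "left_module R M" "submodule K R M"
  shows "left_module R (quot_module M K)"
proof -
  interpret left_module R M by fact
  note add = quot_module_add[OF assms] and smult = quot_module_smult[OF assms]
  have zero: "K = K +>\<^bsub>M\<^esub> \<zero>\<^bsub>M\<^esub>"
    using coset_eq_self_iff[OF assms(2) M.zero_closed] submoduleE(2)[OF assms(2)] by simp
  let ?Q = "quot_module M K"
  have mem: "A \<in> carrier ?Q \<longleftrightarrow> (\<exists>x\<in>carrier M. A = K +>\<^bsub>M\<^esub> x)" for A
    by (simp add: image_iff)
  have coset: "K +>\<^bsub>M\<^esub> x \<in> carrier ?Q" if "x \<in> carrier M" for x using that by simp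
  \<comment> \<open>This keeps the addition of the quotient folded. The simplification rule for it
    would produce a sum of sets, which is why that rule is deleted in the module laws below.\<close>
  have Q_add: "(K +>\<^bsub>M\<^esub> x) \<oplus>\<^bsub>?Q\<^esub> (K +>\<^bsub>M\<^esub> y) = K +>\<^bsub>M\<^esub> (x \<oplus>\<^bsub>M\<^esub> y)"
    if "x \<in> carrier M" "y \<in> carrier M" for x y
    using add[OF that] by simp
  have "abelian_group ?Q"
  proof (rule abelian_groupI)
    show "\<zero>\<^bsub>?Q\<^esub> \<in> carrier ?Q" using coset[OF M.zero_closed] zero by simp
  next
    fix A assume "A \<in> carrier ?Q"
    then obtain x where x: "x \<in> carrier M" "A = K +>\<^bsub>M\<^esub> x" unfolding mem by blast
    show "\<zero>\<^bsub>?Q\<^esub> \<oplus>\<^bsub>?Q\<^esub> A = A"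
      using add[OF M.zero_closed x(1)] x zero by simp
    have "(K +>\<^bsub>M\<^esub> (\<ominus>\<^bsub>M\<^esub> x)) \<oplus>\<^bsub>?Q\<^esub> A = \<zero>\<^bsub>?Q\<^esub>"
      using add[OF M.a_inv_closed[OF x(1)] x(1)] x zero by (simp add: M.l_neg)
    then show "\<exists>B\<in>carrier ?Q. B \<oplus>\<^bsub>?Q\<^esub> A = \<zero>\<^bsub>?Q\<^esub>" using coset x(1) by blast
    fix B assume "B \<in> carrier ?Q"
    then obtain y where y: "y \<in> carrier M" "B = K +>\<^bsub>M\<^esub> y" unfolding mem by blast
    show "A \<oplus>\<^bsub>?Q\<^esub> B \<in> carrier ?Q" using Q_add x y coset by simp
    show "A \<oplus>\<^bsub>?Q\<^esub> B = B \<oplus>\<^bsub>?Q\<^esub> A"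
      unfolding x(2) y(2) Q_add[OF x(1) y(1)] Q_add[OF y(1) x(1)] using x y by (simp add: M.a_comm)
    fix C assume "C \<in> carrier ?Q"
    then obtain z where z: "z \<in> carrier M" "C = K +>\<^bsub>M\<^esub> z" unfolding mem by blast
    show "A \<oplus>\<^bsub>?Q\<^esub> B \<oplus>\<^bsub>?Q\<^esub> C = A \<oplus>\<^bsub>?Q\<^esub> (B \<oplus>\<^bsub>?Q\<^esub> C)"
      unfolding x(2) y(2) z(2) using x y z by (simp del: quot_module_sels add: Q_add M.a_assoc)
  qed
  moreover have "left_module_axioms R ?Q"
  proof (rule left_module_axioms.intro)
    fix A a assume "A \<in> carrier ?Q" and a: "a \<in> carrier R"
    then obtain x where x: "x \<in> carrier M" "A = K +>\<^bsub>M\<^esub> x" unfolding mem by blast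
    show "a \<odot>\<^bsub>?Q\<^esub> A \<in> carrier ?Q" unfolding x(2) smult[OF a x(1)] using a x coset by blast
    show "(a \<oplus>\<^bsub>R\<^esub> b) \<odot>\<^bsub>?Q\<^esub> A = a \<odot>\<^bsub>?Q\<^esub> A \<oplus>\<^bsub>?Q\<^esub> b \<odot>\<^bsub>?Q\<^esub> A"
      "(a \<otimes>\<^bsub>R\<^esub> b) \<odot>\<^bsub>?Q\<^esub> A = a \<odot>\<^bsub>?Q\<^esub> (b \<odot>\<^bsub>?Q\<^esub> A)"
      if b: "b \<in> carrier R" for b
      unfolding x(2) using a b x(1)
      by (simp_all del: quot_module_sels add: Q_add smult smult_l_distr smult_assoc1)
    fix B assume "B \<in> carrier ?Q"
    then obtain y where y: "y \<in> carrier M" "B = K +>\<^bsub>M\<^esub> y" unfolding mem by blast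
    show "a \<odot>\<^bsub>?Q\<^esub> (A \<oplus>\<^bsub>?Q\<^esub> B) = a \<odot>\<^bsub>?Q\<^esub> A \<oplus>\<^bsub>?Q\<^esub> a \<odot>\<^bsub>?Q\<^esub> B"
      unfolding x(2) y(2) using a x(1) y(1)
      by (simp del: quot_module_sels add: Q_add smult smult_r_distr)
  next
    fix A assume "A \<in> carrier ?Q"
    then obtain x where x: "x \<in> carrier M" "A = K +>\<^bsub>M\<^esub> x" unfolding mem by blast
    show "\<one>\<^bsub>R\<^esub> \<odot>\<^bsub>?Q\<^esub> A = A"
      unfolding x(2) using x(1) by (simp del: quot_module_sels add: smult)
  qed
  ultimately show ?thesis by (intro left_module.intro R.ring_axioms)
qed

text \<open>Cosets and their operations are formed with the operations of M, which a smaller carrier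
  leaves alone. The equation lets H/S be regarded as a submodule of M/S.\<close>

lemma quot_module_restrict:
  "quot_module (M\<lparr>carrier := H\<rparr>) K = (quot_module M K)\<lparr>carrier := (\<lambda>x. K +>\<^bsub>M\<^esub> x) ` H\<rparr>"
  by (auto simp: quot_module_def A_RCOSETS_def' a_r_coset_def' set_add_def')

lemma quot_module_lift:
  assumes M: "left_module R M" and K: "submodule K R M" and X: "left_module R X"
    and \<phi>: "\<phi> \<in> lmod_hom R M X" "\<And>x. x \<in> K \<Longrightarrow> \<phi> x = \<zero>\<^bsub>X\<^esub>"
  obtains h where "h \<in> lmod_hom R (quot_module M K) X"
    "\<And>x. x \<in> carrier M \<Longrightarrow> h (K +>\<^bsub>M\<^esub> x) = \<phi> x"
proof -
  interpret left_module R M by fact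
  interpret X: left_module R X by fact
  \<comment> \<open>Any representative of a coset will do, because \<phi> vanishes on
    \<open>K\<close>.\<close>
  define h where "h = (\<lambda>C. \<phi> (SOME x. x \<in> C))"
  have h: "h (K +>\<^bsub>M\<^esub> x) = \<phi> x" if x: "x \<in> carrier M" for x
  proof -
    define y where "y = (SOME y. y \<in> K +>\<^bsub>M\<^esub> x)"
    have "y \<in> K +>\<^bsub>M\<^esub> x"
      unfolding y_def using self_mem_coset[OF K x] by (rule someI)
    then obtain k where k: "k \<in> K" "y = k \<oplus>\<^bsub>M\<^esub> x" by (auto simp: a_r_coset_def')
    have "k \<in> carrier M" using k submoduleE(1)[OF K] by blast
    then have "\<phi> y = \<phi> x"
      using lmod_homD(2)[OF \<phi>(1), of k x] lmod_homD(1)[OF \<phi>(1) x] k \<phi>(2) x by simp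
    then show ?thesis by (simp add: h_def y_def)
  qed
  note add = quot_module_add[OF M K] and smult = quot_module_smult[OF M K]
  have "restrict h (carrier (quot_module M K)) \<in> lmod_hom R (quot_module M K) X"
    using lmod_homD[OF \<phi>(1)]
    by (intro restrict_lmod_homI left_module_quot_module[OF M K]) (auto simp: h add smult)
  then show thesis using that h by auto
qed

section \<open>Subfactors and the isomorphism theorems\<close>

text \<open>\<open>H / K\<close> is isomorphic to \<open>X\<close>, without forming the quotient.\<close>

definition subfactor ::
    "('a, 'r) ring_scheme \<Rightarrow> ('a, 'b) module \<Rightarrow> ('a, 'c) module \<Rightarrow> 'b set \<Rightarrow> 'b set \<Rightarrow> bool" where
  "subfactor R M X K H \<longleftrightarrow>
    (\<exists>\<phi>\<in>lmod_hom R (M\<lparr>carrier := H\<rparr>) X. \<phi> ` H = carrier X \<and> {x \<in> H. \<phi> x = \<zero>\<^bsub>X\<^esub>} = K)"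

text \<open>This is the first isomorphism theorem in both directions. The factors of
  \<open>F\<close> arrive as quotients and are turned into surjections with prescribed kernel, which
  are easier to restrict and extend; at the end the new factors are turned back into
  quotients.\<close>

lemma lmod_iso_quot_module_iff:
  assumes M: "left_module R M" and X: "left_module R X"
    and H: "submodule H R M" and K: "submodule K R M" "K \<subseteq> H"
  shows "lmod_iso R (quot_module (M\<lparr>carrier := H\<rparr>) K) X \<longleftrightarrow> subfactor R M X K H"
proof -
  interpret M: left_module R M by fact
  interpret X: left_module R X by fact
  let ?H = "M\<lparr>carrier := H\<rparr>"
  let ?Q = "quot_module ?H K"
  have mH: "left_module R ?H" using M.submodule_is_left_module[OF H] .
  have sK: "submodule K R ?H" using M.submodule_of_submodule[OF H K] .
  have mQ: "left_module R ?Q" using left_module_quot_module[OF mH sK] .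
  interpret H: left_module R ?H by fact
  note add = quot_module_add[OF mH sK] and smult = quot_module_smult[OF mH sK]
    and eq_K = H.coset_eq_self_iff[OF sK]
  show ?thesis
  proof
    assume "lmod_iso R ?Q X"
    then obtain h where h: "h \<in> lmod_hom R ?Q X" "bij_betw h (carrier ?Q) (carrier X)"
      by (auto simp: lmod_iso_def)
    have hK: "h K = \<zero>\<^bsub>X\<^esub>" using lmod_hom_zero[OF mQ X h(1)] by simp
    have KQ: "K \<in> carrier ?Q"
      using left_module.axioms(2)[OF mQ] abelian_group.axioms(1) abelian_monoid.zero_closed by fastforce
    let ?\<phi> = "\<lambda>x\<in>carrier ?H. h (K +>\<^bsub>?H\<^esub> x)"
    have "?\<phi> \<in> lmod_hom R ?H X"
    proof (rule restrict_lmod_homI[OF mH])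
      fix x assume x: "x \<in> carrier ?H"
      then show "h (K +>\<^bsub>?H\<^esub> x) \<in> carrier X" using lmod_homD(1)[OF h(1)] by simp
      show "h (K +>\<^bsub>?H\<^esub> (x \<oplus>\<^bsub>?H\<^esub> y)) = h (K +>\<^bsub>?H\<^esub> x) \<oplus>\<^bsub>X\<^esub> h (K +>\<^bsub>?H\<^esub> y)"
        if y: "y \<in> carrier ?H" for y
        using lmod_homD(2)[OF h(1), of "K +>\<^bsub>?H\<^esub> x" "K +>\<^bsub>?H\<^esub> y"] add[OF x y] x y by simp
      show "h (K +>\<^bsub>?H\<^esub> (a \<odot>\<^bsub>?H\<^esub> x)) = a \<odot>\<^bsub>X\<^esub> h (K +>\<^bsub>?H\<^esub> x)" if a: "a \<in> carrier R" for a
        using lmod_homD(3)[OF h(1) a, of "K +>\<^bsub>?H\<^esub> x"] smult[OF a x] x by simp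
    qed
    moreover have "?\<phi> ` H = carrier X"
      using h(2) by (auto simp: bij_betw_def image_image)
    moreover have "?\<phi> x = \<zero>\<^bsub>X\<^esub> \<longleftrightarrow> x \<in> K" if "x \<in> H" for x
    proof -
      have "h (K +>\<^bsub>?H\<^esub> x) = h K \<longleftrightarrow> K +>\<^bsub>?H\<^esub> x = K"
        using h(2) KQ that by (intro inj_on_eq_iff[of h "carrier ?Q"]) (auto simp: bij_betw_def)
      then show ?thesis using hK eq_K[of x] that by simp
    qed
    ultimately show "subfactor R M X K H"
      unfolding subfactor_def using K(2) by (intro bexI[of _ ?\<phi>]) auto
  next
    assume "subfactor R M X K H"
    then obtain \<phi> where \<phi>: "\<phi> \<in> lmod_hom R ?H X" "\<phi> ` H = carrier X" "{x \<in> H. \<phi> x = \<zero>\<^bsub>X\<^esub>} = K"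
      by (auto simp: subfactor_def)
    obtain h where h: "h \<in> lmod_hom R ?Q X" "\<And>x. x \<in> carrier ?H \<Longrightarrow> h (K +>\<^bsub>?H\<^esub> x) = \<phi> x"
      using quot_module_lift[OF mH sK X \<phi>(1)] \<phi>(3) by blast
    have "inj_on h (carrier ?Q)"
    proof (rule inj_onI)
      fix A B assume AB: "A \<in> carrier ?Q" "B \<in> carrier ?Q" "h A = h B"
      obtain x where x: "x \<in> H" "A = K +>\<^bsub>?H\<^esub> x" using AB(1) by auto
      obtain y where y: "y \<in> H" "B = K +>\<^bsub>?H\<^esub> y" using AB(2) by auto
      have "\<phi> x = \<phi> y" using AB(3) x y h(2) by simp
      then have "\<phi> (x \<ominus>\<^bsub>?H\<^esub> y) = \<zero>\<^bsub>X\<^esub>"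
        using lmod_hom_minus[OF mH X \<phi>(1), of x y] lmod_homD(1)[OF \<phi>(1)] x(1) y(1)
        by (simp add: a_minus_def X.M.r_neg)
      moreover have "x \<ominus>\<^bsub>?H\<^esub> y \<in> H" using H.M.minus_closed[of x y] x y by simp
      ultimately have "x \<ominus>\<^bsub>?H\<^esub> y \<in> K" using \<phi>(3) by blast
      then show "A = B" using H.coset_eq_iff[OF sK, of x y] x y by simp
    qed
    moreover have "h ` carrier ?Q = carrier X"
      using h(2) \<phi>(2) by (simp add: image_image)
    ultimately show "lmod_iso R ?Q X" using h(1) by (auto simp: lmod_iso_def bij_betw_def)
  qed
qed

text \<open>Third isomorphism theorem: S lies in the kernel K of \<phi>, so \<phi> factors through
  H/S, with the same image and with kernel K/S.\<close>

lemma subfactor_quot_module: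
  assumes M: "left_module R M" and X: "left_module R X" and S: "submodule S R M"
    and H: "submodule H R M" and K: "submodule K R M" and SK: "S \<subseteq> K" "K \<subseteq> H"
    and sf: "subfactor R M X K H"
  shows "subfactor R (quot_module M S) X ((\<lambda>x. S +>\<^bsub>M\<^esub> x) ` K) ((\<lambda>x. S +>\<^bsub>M\<^esub> x) ` H)"
proof -
  interpret M: left_module R M by fact
  let ?H = "M\<lparr>carrier := H\<rparr>"
  obtain \<phi> where \<phi>: "\<phi> \<in> lmod_hom R ?H X" "\<phi> ` H = carrier X" "{x \<in> H. \<phi> x = \<zero>\<^bsub>X\<^esub>} = K"
    using sf by (auto simp: subfactor_def)
  have mH: "left_module R ?H" using M.submodule_is_left_module[OF H] .
  have sS: "submodule S R ?H" using M.submodule_of_submodule[OF H S] SK by blast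
  obtain h where h: "h \<in> lmod_hom R (quot_module ?H S) X"
    "\<And>x. x \<in> carrier ?H \<Longrightarrow> h (S +>\<^bsub>?H\<^esub> x) = \<phi> x"
    using quot_module_lift[OF mH sS X \<phi>(1)] \<phi>(3) SK(1) by blast
  have h': "h (S +>\<^bsub>M\<^esub> x) = \<phi> x" if "x \<in> H" for x
    using h(2)[of x] that by (simp add: a_r_coset_def')
  show ?thesis
    unfolding subfactor_def
  proof (intro bexI[of _ h] conjI)
    show "h ` (\<lambda>x. S +>\<^bsub>M\<^esub> x) ` H = carrier X" using \<phi>(2) h' by (simp add: image_image)
    show "{A \<in> (\<lambda>x. S +>\<^bsub>M\<^esub> x) ` H. h A = \<zero>\<^bsub>X\<^esub>} = (\<lambda>x. S +>\<^bsub>M\<^esub> x) ` K"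
      unfolding \<phi>(3)[symmetric] using h' by auto
    show "h \<in> lmod_hom R ((quot_module M S)\<lparr>carrier := (\<lambda>x. S +>\<^bsub>M\<^esub> x) ` H\<rparr>) X"
      using h(1) unfolding quot_module_restrict .
  qed
qed

text \<open>A form of the second isomorphism theorem. The map sends x + u to \<phi> x; the
  H-components of two decompositions of one element differ by an element of H \<inter> S, which lies
  in the kernel K.\<close>

lemma subfactor_set_add:
  assumes M: "left_module R M" and X: "left_module R X" and S: "submodule S R M"
    and H: "submodule H R M" and K: "submodule K R M"
    and inter: "H \<inter> S \<subseteq> K" and sf: "subfactor R M X K H"
  shows "subfactor R M X (K <+>\<^bsub>M\<^esub> S) (H <+>\<^bsub>M\<^esub> S)"
proof -
  interpret M: left_module R M by fact
  interpret X: left_module R X by fact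
  let ?H = "M\<lparr>carrier := H\<rparr>" and ?HS = "M\<lparr>carrier := H <+>\<^bsub>M\<^esub> S\<rparr>"
  obtain \<phi> where \<phi>: "\<phi> \<in> lmod_hom R ?H X" "\<phi> ` H = carrier X" "{x \<in> H. \<phi> x = \<zero>\<^bsub>X\<^esub>} = K"
    using sf by (auto simp: subfactor_def)
  note h = M.submoduleE[OF H] and s = M.submoduleE[OF S]
  have hc: "x \<in> carrier M" if "x \<in> H" for x using h(1) that by blast
  have sc: "x \<in> carrier M" if "x \<in> S" for x using s(1) that by blast
  have KH: "K \<subseteq> H" using \<phi>(3) by blast
  have mH: "left_module R ?H" using M.submodule_is_left_module[OF H] .
  have mHS: "left_module R ?HS"
    using M.submodule_is_left_module[OF M.submodule_set_add(1)[OF H S]] .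
  have wd: "\<phi> x = \<phi> y"
    if x: "x \<in> H" and y: "y \<in> H" and u: "u \<in> S" and v: "v \<in> S"
      and eq: "x \<oplus>\<^bsub>M\<^esub> u = y \<oplus>\<^bsub>M\<^esub> v" for x y u v
  proof -
    have "x = x \<oplus>\<^bsub>M\<^esub> u \<ominus>\<^bsub>M\<^esub> u"
      using hc[OF x] sc[OF u] by (simp add: a_minus_def M.a_assoc M.r_neg)
    also have "\<dots> = (v \<ominus>\<^bsub>M\<^esub> u) \<oplus>\<^bsub>M\<^esub> y"
      unfolding eq using hc[OF y] sc[OF u] sc[OF v] by (simp add: a_minus_def M.a_ac)
    finally have x_eq: "x = (v \<ominus>\<^bsub>M\<^esub> u) \<oplus>\<^bsub>M\<^esub> y" .
    have vu: "v \<ominus>\<^bsub>M\<^esub> u \<in> S" using s(6) u v by simp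
    have "v \<ominus>\<^bsub>M\<^esub> u = x \<ominus>\<^bsub>M\<^esub> y"
      using x_eq hc[OF y] sc[OF vu] by (simp add: a_minus_def M.a_assoc M.r_neg)
    then have "v \<ominus>\<^bsub>M\<^esub> u \<in> H" using h(6) x y by simp
    then have *: "v \<ominus>\<^bsub>M\<^esub> u \<in> H" "\<phi> (v \<ominus>\<^bsub>M\<^esub> u) = \<zero>\<^bsub>X\<^esub>" using vu inter \<phi>(3) by auto
    show ?thesis
      using lmod_homD(2)[OF \<phi>(1), of "v \<ominus>\<^bsub>M\<^esub> u" y] * x_eq y lmod_homD(1)[OF \<phi>(1), of y] by simp
  qed
  \<comment> \<open>\<open>p\<close> picks some component in \<open>H\<close>; by \<open>wd\<close>
    the value of \<phi> on it does not depend on the choice.\<close>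
  define p where "p = (\<lambda>z. SOME x. x \<in> H \<and> (\<exists>u\<in>S. z = x \<oplus>\<^bsub>M\<^esub> u))"
  have p: "\<phi> (p (x \<oplus>\<^bsub>M\<^esub> u)) = \<phi> x" if "x \<in> H" "u \<in> S" for x u
  proof -
    have "\<exists>y. y \<in> H \<and> (\<exists>v\<in>S. x \<oplus>\<^bsub>M\<^esub> u = y \<oplus>\<^bsub>M\<^esub> v)" using that by blast
    then have "p (x \<oplus>\<^bsub>M\<^esub> u) \<in> H \<and> (\<exists>v\<in>S. x \<oplus>\<^bsub>M\<^esub> u = p (x \<oplus>\<^bsub>M\<^esub> u) \<oplus>\<^bsub>M\<^esub> v)"
      unfolding p_def by (rule someI_ex)
    then show ?thesis using wd that by metis
  qed
  let ?\<psi> = "\<lambda>z\<in>carrier ?HS. \<phi> (p z)"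
  have \<psi>: "?\<psi> (x \<oplus>\<^bsub>M\<^esub> u) = \<phi> x" if "x \<in> H" "u \<in> S" for x u
    using p[OF that] that by (auto simp: M.set_add_iff)
  have "?\<psi> \<in> lmod_hom R ?HS X"
  proof (rule restrict_lmod_homI[OF mHS])
    fix z assume "z \<in> carrier ?HS"
    then obtain x u where z: "x \<in> H" "u \<in> S" "z = x \<oplus>\<^bsub>M\<^esub> u" by (auto simp: M.set_add_iff)
    then show "\<phi> (p z) \<in> carrier X" using p lmod_homD(1)[OF \<phi>(1)] by simp
    show "\<phi> (p (a \<odot>\<^bsub>?HS\<^esub> z)) = a \<odot>\<^bsub>X\<^esub> \<phi> (p z)" if a: "a \<in> carrier R" for a
    proof -
      have "a \<odot>\<^bsub>?HS\<^esub> z = a \<odot>\<^bsub>M\<^esub> x \<oplus>\<^bsub>M\<^esub> a \<odot>\<^bsub>M\<^esub> u"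
        using z a hc sc by (simp add: M.smult_r_distr)
      then show ?thesis
        using p[OF h(4)[OF a z(1)] s(4)[OF a z(2)]] p[OF z(1,2)] z
          lmod_homD(3)[OF \<phi>(1) a, of x] by simp
    qed
    fix z' assume "z' \<in> carrier ?HS"
    then obtain x' u' where z': "x' \<in> H" "u' \<in> S" "z' = x' \<oplus>\<^bsub>M\<^esub> u'" by (auto simp: M.set_add_iff)
    have "z \<oplus>\<^bsub>M\<^esub> z' = (x \<oplus>\<^bsub>M\<^esub> x') \<oplus>\<^bsub>M\<^esub> (u \<oplus>\<^bsub>M\<^esub> u')"
      using z z' hc sc by (simp add: M.a_ac)
    then show "\<phi> (p (z \<oplus>\<^bsub>?HS\<^esub> z')) = \<phi> (p z) \<oplus>\<^bsub>X\<^esub> \<phi> (p z')"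
      using p[OF h(3)[OF z(1) z'(1)] s(3)[OF z(2) z'(2)]] p[OF z(1,2)] p[OF z'(1,2)] z z'
        lmod_homD(2)[OF \<phi>(1), of x x'] by simp
  qed
  moreover have "?\<psi> ` (H <+>\<^bsub>M\<^esub> S) = carrier X"
  proof (intro subset_antisym subsetI)
    fix y assume "y \<in> ?\<psi> ` (H <+>\<^bsub>M\<^esub> S)"
    then obtain z where z: "z \<in> H <+>\<^bsub>M\<^esub> S" "y = ?\<psi> z" by (rule imageE)
    then obtain x u where "x \<in> H" "u \<in> S" "y = ?\<psi> (x \<oplus>\<^bsub>M\<^esub> u)" unfolding M.set_add_iff by blast
    then show "y \<in> carrier X" using \<psi>[of x u] lmod_homD(1)[OF \<phi>(1), of x] by simp
  next
    fix y assume "y \<in> carrier X"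
    then obtain x where x: "x \<in> H" "y = \<phi> x" using \<phi>(2) by blast
    then have "y = ?\<psi> (x \<oplus>\<^bsub>M\<^esub> \<zero>\<^bsub>M\<^esub>)" using \<psi>[OF x(1) s(2)] by simp
    moreover have "x \<oplus>\<^bsub>M\<^esub> \<zero>\<^bsub>M\<^esub> \<in> H <+>\<^bsub>M\<^esub> S" using x(1) s(2) by (auto simp: M.set_add_iff)
    ultimately show "y \<in> ?\<psi> ` (H <+>\<^bsub>M\<^esub> S)" by (rule image_eqI)
  qed
  moreover have "{z \<in> H <+>\<^bsub>M\<^esub> S. ?\<psi> z = \<zero>\<^bsub>X\<^esub>} = K <+>\<^bsub>M\<^esub> S"
  proof (intro subset_antisym subsetI)
    fix z assume "z \<in> {z \<in> H <+>\<^bsub>M\<^esub> S. ?\<psi> z = \<zero>\<^bsub>X\<^esub>}"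
    then obtain x u where z: "x \<in> H" "u \<in> S" "z = x \<oplus>\<^bsub>M\<^esub> u" "?\<psi> z = \<zero>\<^bsub>X\<^esub>"
      by (auto simp: M.set_add_iff)
    then have "x \<in> K" using \<psi>[of x u] \<phi>(3) by auto
    then show "z \<in> K <+>\<^bsub>M\<^esub> S" using z by (auto simp: M.set_add_iff)
  next
    fix z assume "z \<in> K <+>\<^bsub>M\<^esub> S"
    then obtain x u where z: "x \<in> K" "u \<in> S" "z = x \<oplus>\<^bsub>M\<^esub> u" by (auto simp: M.set_add_iff)
    then have "x \<in> H" "\<phi> x = \<zero>\<^bsub>X\<^esub>" using \<phi>(3) by auto
    then show "z \<in> {z \<in> H <+>\<^bsub>M\<^esub> S. ?\<psi> z = \<zero>\<^bsub>X\<^esub>}"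
      using \<psi>[of x u] z by (auto simp: M.set_add_iff)
  qed
  ultimately show ?thesis unfolding subfactor_def by (intro bexI[of _ ?\<psi>] conjI)
qed

section \<open>The socle as a sum of complements\<close>


locale semibrick_filtration = left_module R M
  for R :: "('a, 'r) ring_scheme" (structure) and M :: "('a, 'b) module" (structure) +
  fixes \<X> :: "('a, 'x) module set" and r :: "'i rel" and \<mu> :: 'i and F :: "'i \<Rightarrow> 'b set"
  assumes semibrick: "semibrick R \<X>"
    and X_filtration: "X_filtration R \<X> M r \<mu> F"
begin

abbreviation sc :: "'i \<Rightarrow> 'i" where
  "sc \<alpha> \<equiv> wo_rel.suc r {\<alpha>}"

lemma lM: "left_module R M" ..

lemma X_module: "X \<in> \<X> \<Longrightarrow> left_module R X"
  and X_fp: "X \<in> \<X> \<Longrightarrow> finitely_presented R X"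
  using semibrick by (auto simp: semibrick_def brick_def)

lemma r: "Well_order r"
  and mu: "\<mu> \<in> Field r"
  and F_sub: "\<alpha> \<in> under r \<mu> \<Longrightarrow> submodule (F \<alpha>) R M"
  and F_mono: "\<beta> \<in> under r \<mu> \<Longrightarrow> \<alpha> \<in> under r \<beta> \<Longrightarrow> F \<alpha> \<subseteq> F \<beta>"
  and F_zero: "\<nu> \<in> under r \<mu> \<Longrightarrow> is_zero_ord r \<nu> \<Longrightarrow> F \<nu> = {\<zero>\<^bsub>M\<^esub>}"
  and F_top: "F \<mu> = carrier M"
  and F_limit: "\<nu> \<in> under r \<mu> \<Longrightarrow> is_limit_ord r \<nu> \<Longrightarrow> F \<nu> = (\<Union>\<alpha>\<in>underS r \<nu>. F \<alpha>)"
  and F_iso: "\<alpha> \<in> underS r \<mu> \<Longrightarrow>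
    \<exists>X\<in>\<X>. lmod_iso R (quot_module (M\<lparr>carrier := F (sc \<alpha>)\<rparr>) (F \<alpha>)) X"
  using X_filtration unfolding X_filtration_def filtration_def by simp_all

lemma mu_refl: "\<mu> \<in> under r \<mu>"
  using r mu by (simp add: Refl_under_in order_on_defs)

lemma sc_facts:
  assumes "\<alpha> \<in> underS r \<mu>"
  shows "\<alpha> \<in> underS r (sc \<alpha>)" "\<alpha> \<in> under r (sc \<alpha>)" "sc \<alpha> \<in> under r \<mu>"
    "underS r (sc \<alpha>) = under r \<alpha>" "\<alpha> \<in> under r \<mu>" "F \<alpha> \<subseteq> F (sc \<alpha>)"
proof -
  note * = suc_ord[OF r assms]
  show "\<alpha> \<in> underS r (sc \<alpha>)" "sc \<alpha> \<in> under r \<mu>" "underS r (sc \<alpha>) = under r \<alpha>" by (fact *)+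
  show u: "\<alpha> \<in> under r (sc \<alpha>)" using underS_under[OF *(1)] .
  show "\<alpha> \<in> under r \<mu>" using underS_under[OF assms] .
  show "F \<alpha> \<subseteq> F (sc \<alpha>)" using F_mono[OF *(2) u] .
qed

lemma F_factor:
  assumes "\<alpha> \<in> underS r \<mu>"
  obtains X where "X \<in> \<X>" "subfactor R M X (F \<alpha>) (F (sc \<alpha>))"
proof -
  note a = sc_facts[OF assms]
  obtain X where X: "X \<in> \<X>" "lmod_iso R (quot_module (M\<lparr>carrier := F (sc \<alpha>)\<rparr>) (F \<alpha>)) X"
    using F_iso[OF assms] by blast
  then show thesis
    using that lmod_iso_quot_module_iff[OF lM X_module[OF X(1)] F_sub[OF a(3)] F_sub[OF a(5)] a(6)]
    by blast
qed

section \<open>Splitting a single step of the filtration\<close>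

text \<open>
  The image of \<open>X\<close> is then a complement of \<open>F \<alpha>\<close> in \<open>F (\<alpha> + 1)\<close>, because a nonzero map between
  members of a semibrick is bijective.
\<close>

definition splits :: "'i \<Rightarrow> 'b set \<Rightarrow> bool" where
  "splits \<alpha> T \<longleftrightarrow> \<alpha> \<in> underS r \<mu> \<and>
    (\<exists>X\<in>\<X>. \<exists>f\<in>lmod_hom R X M. T = f ` carrier X \<and> T \<subseteq> F (sc \<alpha>) \<and> \<not> T \<subseteq> F \<alpha>)"

text \<open>Some \<open>f x\<close> lies outside \<open>F \<alpha>\<close>, the kernel of \<phi>, so
  the composite is nonzero and therefore bijective. Leaving \<phi> arbitrary allows two splitting
  maps to be compared through the same \<phi>.\<close>

lemma composite_bij:
  assumes \<alpha>: "\<alpha> \<in> underS r \<mu>" and X: "X \<in> \<X>" and f: "f \<in> lmod_hom R X M"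
    and im: "f ` carrier X \<subseteq> F (sc \<alpha>)" "\<not> f ` carrier X \<subseteq> F \<alpha>"
    and Y: "Y \<in> \<X>" and \<phi>: "\<phi> \<in> lmod_hom R (M\<lparr>carrier := F (sc \<alpha>)\<rparr>) Y"
    and ker: "{x \<in> F (sc \<alpha>). \<phi> x = \<zero>\<^bsub>Y\<^esub>} = F \<alpha>"
  shows "compose (carrier X) \<phi> f \<in> lmod_hom R X Y"
    and "bij_betw (compose (carrier X) \<phi> f) (carrier X) (carrier Y)"
proof -
  show hom: "compose (carrier X) \<phi> f \<in> lmod_hom R X Y"
    using compose_lmod_hom[OF X_module[OF X] lmod_hom_codomain_submodule[OF f im(1)] \<phi>] .
  obtain x where x: "x \<in> carrier X" "f x \<notin> F \<alpha>" using im(2) by blast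
  have "\<phi> (f x) \<noteq> \<zero>\<^bsub>Y\<^esub>" using x im(1) ker by blast
  then have "compose (carrier X) \<phi> f \<noteq> zero_hom X Y"
    using zero_hom_iff[OF hom] x(1) by (auto simp: compose_eq)
  then show "bij_betw (compose (carrier X) \<phi> f) (carrier X) (carrier Y)"
    using semibrick_hom_bij[OF semibrick X Y hom] by simp
qed

text \<open>Bijectivity of the composite has two halves: injectivity makes the intersection with
  \<open>F \<alpha>\<close> zero, and surjectivity means that \<open>T\<close> alone covers the
  factor. The second half is stated for every \<phi> with kernel \<open>F \<alpha>\<close>, since
  the later arguments bring a \<phi> of their own.\<close>

lemma splits_facts:
  assumes "splits \<alpha> T"
  shows "\<alpha> \<in> underS r \<mu>" "submodule T R M" "T \<subseteq> F (sc \<alpha>)" "T \<inter> F \<alpha> \<subseteq> {\<zero>\<^bsub>M\<^esub>}"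
    and "\<And>Y \<phi>. Y \<in> \<X> \<Longrightarrow> \<phi> \<in> lmod_hom R (M\<lparr>carrier := F (sc \<alpha>)\<rparr>) Y \<Longrightarrow>
      {x \<in> F (sc \<alpha>). \<phi> x = \<zero>\<^bsub>Y\<^esub>} = F \<alpha> \<Longrightarrow> \<phi> ` T = carrier Y"
proof -
  obtain X f where X: "X \<in> \<X>" and f: "f \<in> lmod_hom R X M" and T: "T = f ` carrier X"
    and im: "f ` carrier X \<subseteq> F (sc \<alpha>)" "\<not> f ` carrier X \<subseteq> F \<alpha>" and \<alpha>: "\<alpha> \<in> underS r \<mu>"
    using assms unfolding splits_def by blast
  note mX = X_module[OF X]
  note bij = composite_bij[OF \<alpha> X f im]
  show "\<alpha> \<in> underS r \<mu>" "T \<subseteq> F (sc \<alpha>)" using \<alpha> T im by auto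
  show "submodule T R M"
    unfolding T using lmod_hom_image_submodule[OF mX lM f left_module.carrier_is_submodule[OF mX]] .
  show "\<phi> ` T = carrier Y"
    if "Y \<in> \<X>" "\<phi> \<in> lmod_hom R (M\<lparr>carrier := F (sc \<alpha>)\<rparr>) Y" "{x \<in> F (sc \<alpha>). \<phi> x = \<zero>\<^bsub>Y\<^esub>} = F \<alpha>" for Y \<phi>
    using bij(2)[OF that] by (simp add: T bij_betw_def compose_def image_image cong: image_cong)
  obtain Y where Y: "Y \<in> \<X>" "subfactor R M Y (F \<alpha>) (F (sc \<alpha>))" by (rule F_factor[OF \<alpha>])
  obtain \<phi> where \<phi>: "\<phi> \<in> lmod_hom R (M\<lparr>carrier := F (sc \<alpha>)\<rparr>) Y"
    "{x \<in> F (sc \<alpha>). \<phi> x = \<zero>\<^bsub>Y\<^esub>} = F \<alpha>"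
    using Y(2) unfolding subfactor_def by blast
  note hom = bij(1)[OF Y(1) \<phi>] and b = bij(2)[OF Y(1) \<phi>]
  show "T \<inter> F \<alpha> \<subseteq> {\<zero>\<^bsub>M\<^esub>}"
  proof
    fix t assume "t \<in> T \<inter> F \<alpha>"
    then obtain x where x: "x \<in> carrier X" "t = f x" "f x \<in> F \<alpha>" unfolding T by blast
    have z: "\<zero>\<^bsub>X\<^esub> \<in> carrier X"
      using left_module.submoduleE(2)[OF mX left_module.carrier_is_submodule[OF mX]] .
    have "\<phi> (f x) = \<zero>\<^bsub>Y\<^esub>" using x(3) \<phi>(2) by blast
    then have "compose (carrier X) \<phi> f x = compose (carrier X) \<phi> f \<zero>\<^bsub>X\<^esub>"
      using lmod_hom_zero[OF mX X_module[OF Y(1)] hom] x(1) by (simp add: compose_eq)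
    then have "x = \<zero>\<^bsub>X\<^esub>" using b x(1) z by (auto simp: bij_betw_def dest: inj_onD)
    then show "t \<in> {\<zero>\<^bsub>M\<^esub>}" using x(2) lmod_hom_zero[OF mX lM f] by simp
  qed
qed

section \<open>The chosen complements and their partial sums\<close>

definition I :: "'i set" where
  "I = {\<alpha>. \<exists>T. splits \<alpha> T}"

definition T :: "'i \<Rightarrow> 'b set" where
  "T \<alpha> = (SOME T. splits \<alpha> T)"

lemma T: "\<alpha> \<in> I \<Longrightarrow> splits \<alpha> (T \<alpha>)"
  unfolding I_def T_def by (blast intro: someI)

text \<open>The sum of the chosen complements \<open>T \<beta>\<close> with \<open>\<beta> < \<alpha>\<close>; it turns out to be
  \<open>F \<alpha> \<inter> soc M\<close>.\<close>

definition P :: "'i \<Rightarrow> 'b set" where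
  "P \<alpha> = gen_submodule R M (\<Union>\<beta>\<in>I \<inter> underS r \<alpha>. T \<beta>)"

lemma T_carrier: "\<beta> \<in> I \<Longrightarrow> T \<beta> \<subseteq> carrier M"
  using submoduleE(1) splits_facts(2)[OF T] by simp

lemma P_sub: "submodule (P \<alpha>) R M"
  and T_le_P: "\<beta> \<in> I \<Longrightarrow> \<beta> \<in> underS r \<alpha> \<Longrightarrow> T \<beta> \<subseteq> P \<alpha>"
  and P_least: "submodule H R M \<Longrightarrow> (\<And>\<beta>. \<beta> \<in> I \<Longrightarrow> \<beta> \<in> underS r \<alpha> \<Longrightarrow> T \<beta> \<subseteq> H) \<Longrightarrow> P \<alpha> \<subseteq> H"
proof -
  have c: "(\<Union>\<beta>\<in>I \<inter> underS r \<alpha>. T \<beta>) \<subseteq> carrier M" using T_carrier by blast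
  note * = gen_submodule[OF lM c, folded P_def]
  show "submodule (P \<alpha>) R M" by (fact *(1))
  show "T \<beta> \<subseteq> P \<alpha>" if "\<beta> \<in> I" "\<beta> \<in> underS r \<alpha>" using *(2) that by blast
  show "P \<alpha> \<subseteq> H" if "submodule H R M" "\<And>\<beta>. \<beta> \<in> I \<Longrightarrow> \<beta> \<in> underS r \<alpha> \<Longrightarrow> T \<beta> \<subseteq> H"
    using *(3)[OF that(1)] that(2) by (meson IntD1 IntD2 UN_least)
qed

lemma P_mono: "\<alpha> \<in> under r \<beta> \<Longrightarrow> P \<alpha> \<subseteq> P \<beta>"
  using P_least[OF P_sub] T_le_P underS_under_trans[OF r] by blast

lemma P_le_F:
  assumes "\<alpha> \<in> under r \<mu>"
  shows "P \<alpha> \<subseteq> F \<alpha>"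
proof (rule P_least[OF F_sub[OF assms]])
  fix \<beta> assume b: "\<beta> \<in> I" "\<beta> \<in> underS r \<alpha>"
  show "T \<beta> \<subseteq> F \<alpha>"
    using splits_facts(3)[OF T[OF b(1)]] F_mono[OF assms suc_ord(2)[OF r b(2)]] by simp
qed

lemma P_zero:
  assumes "\<nu> \<in> under r \<mu>" "is_zero_ord r \<nu>"
  shows "P \<nu> = {\<zero>\<^bsub>M\<^esub>}"
  using P_le_F[OF assms(1)] F_zero[OF assms] submoduleE(2)[OF P_sub[of \<nu>]] by blast

lemma P_suc_out:
  assumes "\<alpha> \<in> underS r \<mu>" "\<alpha> \<notin> I"
  shows "P (sc \<alpha>) = P \<alpha>"
proof -
  have "\<alpha> \<in> under r \<alpha>"
    using r assms(1) by (intro Refl_under_in) (auto simp: order_on_defs underS_def Field_def)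
  then have "under r \<alpha> = insert \<alpha> (underS r \<alpha>)" by (auto simp: under_def underS_def)
  then have "I \<inter> underS r (sc \<alpha>) = I \<inter> underS r \<alpha>"
    using assms(2) by (simp add: sc_facts(4)[OF assms(1)])
  then show ?thesis unfolding P_def by simp
qed

lemma P_suc_in:
  assumes "\<alpha> \<in> I"
  shows "P (sc \<alpha>) \<subseteq> P \<alpha> <+>\<^bsub>M\<^esub> T \<alpha>"
proof -
  note t = splits_facts[OF T[OF assms]]
  note add = submodule_set_add[OF P_sub[of \<alpha>] t(2)]
  show ?thesis
  proof (rule P_least[OF add(1)])
    fix \<beta> assume b: "\<beta> \<in> I" "\<beta> \<in> underS r (sc \<alpha>)"
    then have "\<beta> \<in> under r \<alpha>" using sc_facts(4)[OF t(1)] by simp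
    then have "\<beta> = \<alpha> \<or> \<beta> \<in> underS r \<alpha>" by (auto simp: under_def underS_def)
    then show "T \<beta> \<subseteq> P \<alpha> <+>\<^bsub>M\<^esub> T \<alpha>"
      using add(2,3) T_le_P[OF b(1), of \<alpha>] by blast
  qed
qed

text \<open>Each summand \<open>T \<beta>\<close> has already entered at stage \<beta> + 1, which is
  still below the limit.\<close>

lemma P_limit:
  assumes "\<nu> \<in> under r \<mu>" "is_limit_ord r \<nu>"
  shows "P \<nu> \<subseteq> (\<Union>\<alpha>\<in>underS r \<nu>. P \<alpha>)"
proof (rule P_least)
  show "submodule (\<Union>\<alpha>\<in>underS r \<nu>. P \<alpha>) R M"
  proof (rule submodule_directed_Union)
    show "underS r \<nu> \<noteq> {}" using assms(2) by (simp add: is_limit_ord_def)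
    fix \<alpha> \<beta> assume ab: "\<alpha> \<in> underS r \<nu>" "\<beta> \<in> underS r \<nu>"
    show "P \<alpha> \<subseteq> P \<beta> \<or> P \<beta> \<subseteq> P \<alpha>"
      using well_order_linear[OF r underS_under[OF ab(1)] underS_under[OF ab(2)]] P_mono underS_under
      by metis
  qed (rule P_sub)
  fix \<beta> assume b: "\<beta> \<in> I" "\<beta> \<in> underS r \<nu>"
  have "T \<beta> \<subseteq> P (sc \<beta>)" using T_le_P[OF b(1) suc_ord(1)[OF r b(2)]] .
  then show "T \<beta> \<subseteq> (\<Union>\<alpha>\<in>underS r \<nu>. P \<alpha>)" using limit_ord_suc[OF r assms(2) b(2)] by blast
qed

text \<open>Induction on \<gamma> with \<alpha> fixed. For \<alpha> \<le> \<beta>, let y + z lie in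
  \<open>F \<alpha>\<close>, with y in \<open>P \<beta>\<close> and z in \<open>T \<beta>\<close>.
  Then z lies in both \<open>T \<beta>\<close> and \<open>F \<beta>\<close>, hence is 0, so the step
  from \<beta> to \<beta> + 1 adds nothing to the intersection with \<open>F \<alpha>\<close>. The
  case \<gamma> = \<mu> controls how the socle meets each stage.\<close>

lemma P_Int_F:
  assumes \<gamma>: "\<gamma> \<in> under r \<mu>" and \<alpha>: "\<alpha> \<in> under r \<mu>"
  shows "P \<gamma> \<inter> F \<alpha> \<subseteq> P \<alpha>"
  using r \<gamma>
proof (induction \<gamma> rule: ord_induct)
  case (zero \<nu>)
  then show ?case using P_zero submoduleE(2)[OF P_sub[of \<alpha>]] by auto
next
  case (suc \<beta>)
  note b = sc_facts[OF suc(1)]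
  show ?case
  proof (rule well_order_linear[OF r b(3) \<alpha>])
    assume "sc \<beta> \<in> under r \<alpha>"
    then show ?thesis using P_mono by blast
  next
    assume "\<alpha> \<in> underS r (sc \<beta>)"
    then have ab: "F \<alpha> \<subseteq> F \<beta>" using b(4) F_mono[OF b(5)] by simp
    show ?thesis
    proof (cases "\<beta> \<in> I")
      case False
      then show ?thesis using suc(2) P_suc_out[OF suc(1)] by simp
    next
      case True
      note t = splits_facts[OF T[OF True]]
      show ?thesis
      proof
        fix x assume x: "x \<in> P (sc \<beta>) \<inter> F \<alpha>"
        then have "x \<in> P \<beta> <+>\<^bsub>M\<^esub> T \<beta>" using P_suc_in[OF True] by blast
        then obtain y z where yz: "y \<in> P \<beta>" "z \<in> T \<beta>" "x = y \<oplus>\<^bsub>M\<^esub> z"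
          unfolding set_add_iff by blast
        have c: "y \<in> carrier M" "z \<in> carrier M"
          using yz submoduleE(1)[OF P_sub[of \<beta>]] submoduleE(1)[OF t(2)] by auto
        have "x \<in> F \<beta>" "y \<in> F \<beta>" using x ab yz(1) P_le_F[OF b(5)] by auto
        then have "x \<ominus>\<^bsub>M\<^esub> y \<in> F \<beta>" using submoduleE(6)[OF F_sub[OF b(5)]] by simp
        moreover have "x \<ominus>\<^bsub>M\<^esub> y = z"
          unfolding yz(3) using M.add_minus_cancel_left[OF c] .
        ultimately have "z = \<zero>\<^bsub>M\<^esub>" using t(4) yz(2) by blast
        then have "x = y" using yz(3) c by simp
        then show "x \<in> P \<alpha>" using suc(2) yz(1) x by blast
      qed
    qed
  qed
next
  case (limit \<nu>)
  then show ?case using P_limit[OF limit(1,2)] by blast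
qed

text \<open>Finitely many generators land in finitely many earlier stages, and the largest of these
  contains the whole image. Finite presentation of the bricks enters here.\<close>

lemma im_bounded:
  assumes \<nu>: "\<nu> \<in> under r \<mu>" "is_limit_ord r \<nu>" and X: "X \<in> \<X>" and f: "f \<in> lmod_hom R X M"
    and im: "f ` carrier X \<subseteq> F \<nu>"
  obtains \<alpha> where "\<alpha> \<in> underS r \<nu>" "f ` carrier X \<subseteq> F \<alpha>"
proof -
  note mX = X_module[OF X]
  obtain G where G: "finite G" "G \<subseteq> carrier X"
    "\<And>H. submodule H R X \<Longrightarrow> G \<subseteq> H \<Longrightarrow> carrier X \<subseteq> H"
    using finitely_presented_imp_finitely_generated[OF mX X_fp[OF X]] by blast
  have low: "\<alpha> \<in> under r \<mu>" if "\<alpha> \<in> underS r \<nu>" for \<alpha>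
    using under_trans[OF r underS_under[OF that] \<nu>(1)] .
  have "\<exists>\<alpha>\<in>underS r \<nu>. f ` G' \<subseteq> F \<alpha>" if "finite G'" "G' \<subseteq> carrier X" for G'
    using that
  proof (induction G' rule: finite_induct)
    case empty
    then show ?case using \<nu>(2) by (auto simp: is_limit_ord_def)
  next
    case (insert g G')
    then obtain \<alpha> where a: "\<alpha> \<in> underS r \<nu>" "f ` G' \<subseteq> F \<alpha>" by auto
    obtain \<beta> where b: "\<beta> \<in> underS r \<nu>" "f g \<in> F \<beta>"
      using im insert.prems F_limit[OF \<nu>] by blast
    show ?case
    proof (rule well_order_linear[OF r underS_under[OF a(1)] underS_under[OF b(1)]])
      assume "\<alpha> \<in> under r \<beta>"
      then show ?thesis using a b F_mono[OF low[OF b(1)]] by blast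
    next
      assume "\<beta> \<in> underS r \<alpha>"
      then show ?thesis using a b F_mono[OF low[OF a(1)] underS_under] by blast
    qed
  qed
  then obtain \<alpha> where a: "\<alpha> \<in> underS r \<nu>" "f ` G \<subseteq> F \<alpha>" using G(1,2) by blast
  \<comment> \<open>The preimage of \<open>F \<alpha>\<close> is a submodule that contains the
    generators.\<close>
  have "carrier X \<subseteq> {x \<in> carrier X. f x \<in> F \<alpha>}"
    using G(2) a(2) by (intro G(3) lmod_hom_vimage_submodule[OF mX lM f F_sub[OF low[OF a(1)]]]) blast
  then show thesis using that a(1) by blast
qed

text \<open>
  If \<open>f\<close> maps onto \<open>F (\<alpha> + 1) / F \<alpha>\<close>, then subtracting a map with image \<open>T \<alpha>\<close> pushes the image of
  \<open>f\<close> into \<open>F \<alpha>\<close>; this is the induction step.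
\<close>

lemma im_le_P:
  assumes \<nu>: "\<nu> \<in> under r \<mu>" and X: "X \<in> \<X>" and f: "f \<in> lmod_hom R X M"
    and im: "f ` carrier X \<subseteq> F \<nu>"
  shows "f ` carrier X \<subseteq> P \<nu>"
proof -
  \<comment> \<open>The map is quantified inside the induction, because the successor step applies
    the hypothesis to another map with the same source.\<close>
  have "\<forall>f\<in>lmod_hom R X M. f ` carrier X \<subseteq> F \<nu> \<longrightarrow> f ` carrier X \<subseteq> P \<nu>"
    using r \<nu>
  proof (induction \<nu> rule: ord_induct)
    case (zero \<nu>)
    then show ?case using F_zero P_zero by simp
  next
    case (limit \<nu>)
    show ?case
    proof (intro ballI impI)
      fix f assume f: "f \<in> lmod_hom R X M" "f ` carrier X \<subseteq> F \<nu>"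
      obtain \<alpha> where a: "\<alpha> \<in> underS r \<nu>" "f ` carrier X \<subseteq> F \<alpha>"
        by (rule im_bounded[OF limit(1,2) X f])
      then have "f ` carrier X \<subseteq> P \<alpha>" using limit(3)[OF a(1)] f(1) by simp
      then show "f ` carrier X \<subseteq> P \<nu>" using P_mono[OF underS_under[OF a(1)]] by simp
    qed
  next
    case (suc \<alpha>)
    note a = sc_facts[OF suc(1)]
    note mX = X_module[OF X]
    show ?case
    proof (intro ballI impI)
      fix f assume f: "f \<in> lmod_hom R X M" "f ` carrier X \<subseteq> F (sc \<alpha>)"
      note fh = lmod_homD[OF f(1)]
      show "f ` carrier X \<subseteq> P (sc \<alpha>)"
      proof (cases "f ` carrier X \<subseteq> F \<alpha>")
        case True
        then show ?thesis using suc(2) f(1) P_mono[OF a(2)] by blast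
      next
        case False
        then have "splits \<alpha> (f ` carrier X)" unfolding splits_def using X f suc(1) by blast
        then have I: "\<alpha> \<in> I" unfolding I_def by blast
        obtain Y g where Y: "Y \<in> \<X>" and g: "g \<in> lmod_hom R Y M" and Tg: "T \<alpha> = g ` carrier Y"
          and g_im: "g ` carrier Y \<subseteq> F (sc \<alpha>)" "\<not> g ` carrier Y \<subseteq> F \<alpha>"
          using T[OF I] unfolding splits_def by blast
        note mY = X_module[OF Y]
        \<comment> \<open>One \<phi> serves both maps: followed by it, \<open>f\<close> and
          \<open>g\<close> become isomorphisms onto the same Z.\<close>
        obtain Z where Z: "Z \<in> \<X>" "subfactor R M Z (F \<alpha>) (F (sc \<alpha>))" by (rule F_factor[OF suc(1)])
        obtain \<phi> where \<phi>: "\<phi> \<in> lmod_hom R (M\<lparr>carrier := F (sc \<alpha>)\<rparr>) Z"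
          "{x \<in> F (sc \<alpha>). \<phi> x = \<zero>\<^bsub>Z\<^esub>} = F \<alpha>"
          using Z(2) unfolding subfactor_def by blast
        note mZ = X_module[OF Z(1)]
        note gb = composite_bij[OF suc(1) Y g g_im Z(1) \<phi>]
        note fb = composite_bij[OF suc(1) X f False Z(1) \<phi>]
        obtain k where k: "k \<in> lmod_hom R Z Y" "\<And>z. z \<in> carrier Z \<Longrightarrow> compose (carrier Y) \<phi> g (k z) = z"
          using inv_lmod_hom[OF mY mZ gb] by blast
        \<comment> \<open>Inverting the isomorphism from Y to Z that \<open>g\<close> induces lifts
          \<phi> \<circ> f through \<open>g\<close>, so that \<phi> takes the same value at
          \<open>g (q x)\<close> and at \<open>f x\<close>.\<close>
        define q where "q = compose (carrier X) k (compose (carrier X) \<phi> f)"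
        have q: "q \<in> lmod_hom R X Y" unfolding q_def using compose_lmod_hom[OF mX fb(1) k(1)] .
        define h where "h = (\<lambda>x\<in>carrier X. f x \<ominus>\<^bsub>M\<^esub> g (q x))"
        have gqc: "g (q x) \<in> F (sc \<alpha>)" "g (q x) \<in> carrier M" if "x \<in> carrier X" for x
          using lmod_homD(1)[OF q that] g_im(1) lmod_homD(1)[OF g] by auto
        have fc: "f x \<in> F (sc \<alpha>)" if "x \<in> carrier X" for x using f(2) that by blast
        interpret X: left_module R X by (rule mX)
        interpret Z: left_module R Z by (rule mZ)
        have h: "h \<in> lmod_hom R X M"
          unfolding h_def
        proof (rule restrict_lmod_homI[OF mX])
          fix x assume x: "x \<in> carrier X"
          show "f x \<ominus>\<^bsub>M\<^esub> g (q x) \<in> carrier M" using fh(1)[OF x] gqc(2)[OF x] by simp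
          show "f (b \<odot>\<^bsub>X\<^esub> x) \<ominus>\<^bsub>M\<^esub> g (q (b \<odot>\<^bsub>X\<^esub> x)) = b \<odot>\<^bsub>M\<^esub> (f x \<ominus>\<^bsub>M\<^esub> g (q x))"
            if b: "b \<in> carrier R" for b
          proof -
            have "b \<odot>\<^bsub>M\<^esub> (f x \<ominus>\<^bsub>M\<^esub> g (q x)) = b \<odot>\<^bsub>M\<^esub> f x \<ominus>\<^bsub>M\<^esub> b \<odot>\<^bsub>M\<^esub> g (q x)"
              using smult_r_minus[OF b fh(1)[OF x] gqc(2)[OF x]] .
            then show ?thesis
              using fh(3)[OF b x] lmod_homD(3)[OF q b x] lmod_homD(3)[OF g b lmod_homD(1)[OF q x]] by simp
          qed
          show "f (x \<oplus>\<^bsub>X\<^esub> y) \<ominus>\<^bsub>M\<^esub> g (q (x \<oplus>\<^bsub>X\<^esub> y)) = (f x \<ominus>\<^bsub>M\<^esub> g (q x)) \<oplus>\<^bsub>M\<^esub> (f y \<ominus>\<^bsub>M\<^esub> g (q y))"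
            if y: "y \<in> carrier X" for y
          proof -
            have "g (q (x \<oplus>\<^bsub>X\<^esub> y)) = g (q x) \<oplus>\<^bsub>M\<^esub> g (q y)"
              using lmod_homD(2)[OF q x y] lmod_homD(2)[OF g lmod_homD(1)[OF q x] lmod_homD(1)[OF q y]]
              by simp
            then show ?thesis
              using fh(2)[OF x y] fh(1)[OF x] fh(1)[OF y] gqc(2)[OF x] gqc(2)[OF y]
              by (simp add: a_minus_def M.minus_add M.a_ac)
          qed
        qed
        have "h ` carrier X \<subseteq> F \<alpha>"
        proof (rule image_subsetI)
          fix x assume x: "x \<in> carrier X"
          have "\<phi> (g (q x)) = \<phi> (f x)"
            using k(2)[OF lmod_homD(1)[OF fb(1) x]] lmod_homD(1)[OF q x] x
            by (simp add: q_def compose_eq)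
          moreover have \<phi>f: "\<phi> (f x) \<in> carrier Z" using lmod_homD(1)[OF \<phi>(1)] fc[OF x] by simp
          moreover have "\<phi> (g (q x) \<oplus>\<^bsub>M\<^esub> h x) = \<phi> (g (q x)) \<oplus>\<^bsub>Z\<^esub> \<phi> (h x)"
            and hx: "h x \<in> F (sc \<alpha>)"
          proof -
            show "h x \<in> F (sc \<alpha>)"
              using submoduleE(6)[OF F_sub[OF a(3)] fc[OF x] gqc(1)[OF x]] x by (simp add: h_def)
            then show "\<phi> (g (q x) \<oplus>\<^bsub>M\<^esub> h x) = \<phi> (g (q x)) \<oplus>\<^bsub>Z\<^esub> \<phi> (h x)"
              using lmod_homD(2)[OF \<phi>(1), of "g (q x)" "h x"] gqc(1)[OF x] by simp
          qed
          moreover have "g (q x) \<oplus>\<^bsub>M\<^esub> h x = f x"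
            using x M.add_minus_cancel[OF fh(1)[OF x] gqc(2)[OF x]] by (simp add: h_def)
          ultimately have "\<phi> (f x) \<oplus>\<^bsub>Z\<^esub> \<phi> (h x) = \<phi> (f x)" by simp
          moreover have "\<phi> (h x) \<in> carrier Z" using lmod_homD(1)[OF \<phi>(1), of "h x"] hx by simp
          ultimately have "\<phi> (h x) = \<zero>\<^bsub>Z\<^esub>"
            using Z.M.add.l_cancel_one \<phi>f by simp
          then show "h x \<in> F \<alpha>" using hx \<phi>(2) by blast
        qed
        then have hP: "h ` carrier X \<subseteq> P \<alpha>" using suc(2) h by blast
        show ?thesis
        proof (rule image_subsetI)
          fix x assume x: "x \<in> carrier X"
          have "h x \<in> P (sc \<alpha>)" using hP x P_mono[OF a(2)] by blast
          moreover have "g (q x) \<in> P (sc \<alpha>)"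
            using T_le_P[OF I a(1)] lmod_homD(1)[OF q x] unfolding Tg by blast
          moreover have "f x = g (q x) \<oplus>\<^bsub>M\<^esub> h x"
            using x M.add_minus_cancel[OF fh(1)[OF x] gqc(2)[OF x]] by (simp add: h_def)
          ultimately show "f x \<in> P (sc \<alpha>)" using submoduleE(3)[OF P_sub[of "sc \<alpha>"]] by simp
        qed
      qed
    qed
  qed
  then show ?thesis using f im by blast
qed

text \<open>\<open>F \<mu>\<close> is all of M, so \<open>im_le_P\<close> at \<mu> covers every map
  from a member of \<open>\<X>\<close>; conversely, each \<open>T \<beta>\<close> is the image of
  such a map.\<close>

lemma X_socle_eq: "X_socle R \<X> M = P \<mu>"
proof
  let ?S = "\<Union>X\<in>\<X>. \<Union>f\<in>lmod_hom R X M. f ` carrier X"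
  have S: "?S \<subseteq> carrier M" using lmod_homD(1) by fastforce
  have "f ` carrier X \<subseteq> P \<mu>" if "X \<in> \<X>" "f \<in> lmod_hom R X M" for X f
    using im_le_P[OF mu_refl that] lmod_homD(1)[OF that(2)] F_top by blast
  then show "X_socle R \<X> M \<subseteq> P \<mu>"
    unfolding X_socle_def by (intro gen_submodule(3)[OF lM S P_sub]) blast
  show "P \<mu> \<subseteq> X_socle R \<X> M"
    unfolding X_socle_def
  proof (rule P_least[OF gen_submodule(1)[OF lM S]])
    fix \<beta> assume "\<beta> \<in> I"
    then show "T \<beta> \<subseteq> gen_submodule R M ?S"
      using T[of \<beta>] gen_submodule(2)[OF lM S] unfolding splits_def by blast
  qed
qed

end

section \<open>Filtrations through the socle\<close>


context semibrick_filtration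
begin

section \<open>The chains below and above the socle\<close>

definition S :: "'b set" where
  "S = P \<mu>"

definition G :: "'i \<Rightarrow> 'b set" where
  "G \<alpha> = F \<alpha> <+>\<^bsub>M\<^esub> S"

lemma S_sub: "submodule S R M"
  unfolding S_def by (rule P_sub)

lemma G_sub: "\<alpha> \<in> under r \<mu> \<Longrightarrow> submodule (G \<alpha>) R M"
  and F_le_G: "\<alpha> \<in> under r \<mu> \<Longrightarrow> F \<alpha> \<subseteq> G \<alpha>"
  and S_le_G: "\<alpha> \<in> under r \<mu> \<Longrightarrow> S \<subseteq> G \<alpha>"
  and G_least: "\<alpha> \<in> under r \<mu> \<Longrightarrow> submodule H R M \<Longrightarrow> F \<alpha> \<subseteq> H \<Longrightarrow> S \<subseteq> H \<Longrightarrow> G \<alpha> \<subseteq> H"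
  unfolding G_def using submodule_set_add[OF F_sub S_sub] by simp_all

lemma G_mono:
  assumes "\<beta> \<in> under r \<mu>" "\<alpha> \<in> under r \<beta>"
  shows "G \<alpha> \<subseteq> G \<beta>"
  using F_mono[OF assms] unfolding G_def set_add_def' by blast

lemma G_zero:
  assumes "\<nu> \<in> under r \<mu>" "is_zero_ord r \<nu>"
  shows "G \<nu> = S"
  using G_least[OF assms(1) S_sub] S_le_G[OF assms(1)] F_zero[OF assms] submoduleE(2)[OF S_sub] by auto

lemma G_top: "G \<mu> = carrier M"
  using submoduleE(1)[OF G_sub[OF mu_refl]] F_le_G[OF mu_refl] F_top by simp

lemma G_limit:
  assumes "\<nu> \<in> under r \<mu>" "is_limit_ord r \<nu>"
  shows "G \<nu> \<subseteq> (\<Union>\<alpha>\<in>underS r \<nu>. G \<alpha>)"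
  unfolding G_def set_add_def' F_limit[OF assms] by blast

text \<open>For \<alpha> outside \<open>I\<close>, S meets \<open>F (sc \<alpha>)\<close> within
  \<open>P (sc \<alpha>)\<close>, which equals \<open>P \<alpha>\<close> and so lies in
  \<open>F \<alpha>\<close>; adding S then preserves the factor. For \<alpha> in \<open>I\<close>,
  the complement \<open>T \<alpha>\<close> lies in S and covers the factor, which collapses once S
  is added.\<close>

lemma G_suc:
  assumes \<alpha>: "\<alpha> \<in> underS r \<mu>"
  shows "G (sc \<alpha>) = G \<alpha> \<or> (\<exists>X\<in>\<X>. subfactor R M X (G \<alpha>) (G (sc \<alpha>)))"
proof -
  note a = sc_facts[OF \<alpha>]
  obtain X where X: "X \<in> \<X>" "subfactor R M X (F \<alpha>) (F (sc \<alpha>))" by (rule F_factor[OF \<alpha>])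
  show ?thesis
  proof (cases "\<alpha> \<in> I")
    case False
    have "F (sc \<alpha>) \<inter> S \<subseteq> F \<alpha>"
      using P_Int_F[OF mu_refl a(3)] P_suc_out[OF \<alpha> False] P_le_F[OF a(5)] unfolding S_def by blast
    then have "subfactor R M X (G \<alpha>) (G (sc \<alpha>))"
      unfolding G_def
      using subfactor_set_add[OF lM X_module[OF X(1)] S_sub F_sub[OF a(3)] F_sub[OF a(5)] _ X(2)]
      by simp
    then show ?thesis using X(1) by blast
  next
    case True
    obtain \<phi> where \<phi>: "\<phi> \<in> lmod_hom R (M\<lparr>carrier := F (sc \<alpha>)\<rparr>) X"
      "{x \<in> F (sc \<alpha>). \<phi> x = \<zero>\<^bsub>X\<^esub>} = F \<alpha>"
      using X(2) unfolding subfactor_def by blast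
    note t = splits_facts[OF T[OF True]]
    have TS: "T \<alpha> \<subseteq> S" unfolding S_def using T_le_P[OF True \<alpha>] .
    interpret X: left_module R X by (rule X_module[OF X(1)])
    \<comment> \<open>From x one subtracts an element of \<open>T \<alpha>\<close> with the same
      value under \<phi>; the difference lies in \<open>F \<alpha>\<close>.\<close>
    have "F (sc \<alpha>) \<subseteq> G \<alpha>"
    proof
      fix x assume x: "x \<in> F (sc \<alpha>)"
      then have "\<phi> x \<in> \<phi> ` T \<alpha>"
        unfolding t(5)[OF X(1) \<phi>] using lmod_homD(1)[OF \<phi>(1), of x] by simp
      then obtain y where y: "y \<in> T \<alpha>" "\<phi> x = \<phi> y" by blast
      then have yF: "y \<in> F (sc \<alpha>)" using t(3) by blast
      have c: "x \<in> carrier M" "y \<in> carrier M"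
        using x yF submoduleE(1)[OF F_sub[OF a(3)]] by auto
      have xy: "x \<ominus>\<^bsub>M\<^esub> y \<in> F (sc \<alpha>)" using submoduleE(6)[OF F_sub[OF a(3)] x yF] .
      have "x = (x \<ominus>\<^bsub>M\<^esub> y) \<oplus>\<^bsub>M\<^esub> y" using c by (simp add: a_minus_def M.a_assoc M.l_neg)
      then have "\<phi> x = \<phi> (x \<ominus>\<^bsub>M\<^esub> y) \<oplus>\<^bsub>X\<^esub> \<phi> y"
        using lmod_homD(2)[OF \<phi>(1), of "x \<ominus>\<^bsub>M\<^esub> y" y] xy yF by simp
      then have "\<phi> (x \<ominus>\<^bsub>M\<^esub> y) = \<zero>\<^bsub>X\<^esub>"
        using y(2) lmod_homD(1)[OF \<phi>(1), of "x \<ominus>\<^bsub>M\<^esub> y"] lmod_homD(1)[OF \<phi>(1), of y] xy yF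
          X.M.add.l_cancel_one'[of "\<phi> y" "\<phi> (x \<ominus>\<^bsub>M\<^esub> y)"] X.M.a_comm by simp
      then have "x \<ominus>\<^bsub>M\<^esub> y \<in> F \<alpha>" using xy \<phi>(2) by blast
      then show "x \<in> G \<alpha>"
        unfolding G_def set_add_iff using \<open>x = (x \<ominus>\<^bsub>M\<^esub> y) \<oplus>\<^bsub>M\<^esub> y\<close> y(1) TS by blast
    qed
    then have "G (sc \<alpha>) \<subseteq> G \<alpha>"
      using G_least[OF a(3) G_sub[OF a(5)] _ S_le_G[OF a(5)]] by simp
    then show ?thesis using G_mono[OF a(3,2)] by blast
  qed
qed

text \<open>For \<alpha> in \<open>I\<close>, the map on \<open>F (sc \<alpha>)\<close> with kernel
  \<open>F \<alpha>\<close> stays surjective on \<open>P (sc \<alpha>)\<close>, as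
  \<open>T \<alpha>\<close> alone covers the factor. Its kernel there is the intersection with
  \<open>F \<alpha>\<close>, which is \<open>P \<alpha>\<close>, so the factor of \<open>F\<close>
  reappears.\<close>

lemma P_suc:
  assumes \<alpha>: "\<alpha> \<in> underS r \<mu>"
  shows "P (sc \<alpha>) = P \<alpha> \<or> (\<exists>X\<in>\<X>. subfactor R M X (P \<alpha>) (P (sc \<alpha>)))"
proof (cases "\<alpha> \<in> I")
  case False
  then show ?thesis using P_suc_out[OF \<alpha>] by simp
next
  case True
  note a = sc_facts[OF \<alpha>]
  let ?FS = "M\<lparr>carrier := F (sc \<alpha>)\<rparr>"
  obtain X where X: "X \<in> \<X>" "subfactor R M X (F \<alpha>) (F (sc \<alpha>))" by (rule F_factor[OF \<alpha>])
  obtain \<phi> where \<phi>: "\<phi> \<in> lmod_hom R ?FS X"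
    "{x \<in> F (sc \<alpha>). \<phi> x = \<zero>\<^bsub>X\<^esub>} = F \<alpha>"
    using X(2) unfolding subfactor_def by blast
  note t = splits_facts[OF T[OF True]]
  have PF: "P (sc \<alpha>) \<subseteq> F (sc \<alpha>)" using P_le_F[OF a(3)] .
  have "restrict \<phi> (P (sc \<alpha>)) \<in> lmod_hom R (?FS\<lparr>carrier := P (sc \<alpha>)\<rparr>) X"
    using lmod_hom_domain_submodule[OF submodule_is_left_module[OF F_sub[OF a(3)]] \<phi>(1)
        submodule_of_submodule[OF F_sub[OF a(3)] P_sub PF]] .
  then have "restrict \<phi> (P (sc \<alpha>)) \<in> lmod_hom R (M\<lparr>carrier := P (sc \<alpha>)\<rparr>) X" by simp
  moreover have "restrict \<phi> (P (sc \<alpha>)) ` P (sc \<alpha>) = carrier X"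
  proof
    show "restrict \<phi> (P (sc \<alpha>)) ` P (sc \<alpha>) \<subseteq> carrier X"
      using lmod_homD(1)[OF \<phi>(1)] PF by auto
    have "carrier X = \<phi> ` T \<alpha>" using t(5)[OF X(1) \<phi>] by simp
    then show "carrier X \<subseteq> restrict \<phi> (P (sc \<alpha>)) ` P (sc \<alpha>)"
      using T_le_P[OF True a(1)] by auto
  qed
  moreover have "{x \<in> P (sc \<alpha>). restrict \<phi> (P (sc \<alpha>)) x = \<zero>\<^bsub>X\<^esub>} = P (sc \<alpha>) \<inter> F \<alpha>"
    unfolding \<phi>(2)[symmetric] using PF by auto
  moreover have "P (sc \<alpha>) \<inter> F \<alpha> = P \<alpha>"
    using P_Int_F[OF a(3,5)] P_mono[OF a(2)] P_le_F[OF a(5)] by blast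
  ultimately have "subfactor R M X (P \<alpha>) (P (sc \<alpha>))"
    unfolding subfactor_def by (intro bexI[of _ "restrict \<phi> (P (sc \<alpha>))"] conjI) simp_all
  then show ?thesis using X(1) by blast
qed

text \<open>The two chains are glued at \<open>S\<close>, the last member of one and the first of
  the other. Since members index themselves, the index \<xi> is \<open>S\<close>.\<close>

lemma X_filtration_through_socle:
  "\<exists>(s :: 'b set rel) \<nu> N \<xi>. X_filtration R \<X> M s \<nu> N \<and> \<xi> \<in> under s \<nu> \<and> N \<xi> = S"
proof -
  let ?\<Phi> = "\<lambda>K H. \<exists>X\<in>\<X>. subfactor R M X K H"
  let ?\<C> = "P ` under r \<mu> \<union> G ` under r \<mu>"
  let ?s = "{(A, B). A \<in> ?\<C> \<and> B \<in> ?\<C> \<and> A \<subseteq> B}"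
  have "well_chain ?\<Phi> {\<zero>\<^bsub>M\<^esub>} S (P ` under r \<mu>)"
    unfolding S_def
    by (rule well_chain_image[OF r mu P_mono P_zero P_suc P_limit])
  moreover have "well_chain ?\<Phi> S (carrier M) (G ` under r \<mu>)"
    unfolding G_top[symmetric]
    by (rule well_chain_image[OF r mu G_mono G_zero G_suc G_limit])
  ultimately have chain: "well_chain ?\<Phi> {\<zero>\<^bsub>M\<^esub>} (carrier M) ?\<C>"
    by (rule well_chain_append)
  have sub: "submodule C R M" if "C \<in> ?\<C>" for C
    using that P_sub G_sub by blast
  have iso: "\<exists>X\<in>\<X>. lmod_iso R (quot_module (M\<lparr>carrier := H\<rparr>) K) X"
    if "K \<in> ?\<C>" "H \<in> ?\<C>" "K \<subset> H" "?\<Phi> K H" for K H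
  proof -
    obtain X where X: "X \<in> \<X>" "subfactor R M X K H" using \<open>?\<Phi> K H\<close> by blast
    then show ?thesis
      using lmod_iso_quot_module_iff[OF lM X_module[OF X(1)] sub[OF that(2)] sub[OF that(1)]] that(3)
      by blast
  qed
  note filt = well_chain_X_filtration[where \<X> = \<X>, OF chain sub iso]
  have "P \<mu> \<in> P ` under r \<mu>" using mu_refl by (rule imageI)
  then have "S \<in> ?\<C>" unfolding S_def by (rule UnI1)
  moreover have "under ?s (carrier M) = ?\<C>" by (rule filt(2))
  ultimately have "S \<in> under ?s (carrier M)" by simp
  then show ?thesis
    using filt(1) by (intro exI[of _ ?s] exI[of _ "carrier M"] exI[of _ "\<lambda>C. C"] exI[of _ S]) simp
qed

text \<open>The chain \<open>G\<close> starts at \<open>S\<close>, so its images in the quotient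
  start at 0, and they keep its factors by \<open>subfactor_quot_module\<close>. The indices are
  sets of cosets, which is the index type of \<open>in_Filt\<close> for a quotient.\<close>

lemma in_Filt_quot: "in_Filt R \<X> (quot_module M S)"
proof -
  let ?Q = "quot_module M S"
  let ?\<pi> = "\<lambda>x. S +>\<^bsub>M\<^esub> x"
  let ?G = "\<lambda>\<alpha>. ?\<pi> ` G \<alpha>"
  let ?\<Phi> = "\<lambda>K H. \<exists>X\<in>\<X>. subfactor R ?Q X K H"
  let ?\<C> = "?G ` under r \<mu>"
  have mQ: "left_module R ?Q" by (rule left_module_quot_module[OF lM S_sub])
  have "restrict ?\<pi> (carrier M) \<in> lmod_hom R M ?Q"
    by (rule restrict_lmod_homI[OF lM])
      (simp_all add: quot_module_add[OF lM S_sub] quot_module_smult[OF lM S_sub])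
  note \<pi> = lmod_hom_image_submodule[OF lM mQ this]
  have sub_G: "submodule (?G \<alpha>) R ?Q" if "\<alpha> \<in> under r \<mu>" for \<alpha>
  proof -
    have "restrict ?\<pi> (carrier M) ` G \<alpha> = ?G \<alpha>"
      using submoduleE(1)[OF G_sub[OF that]] by (intro image_cong) auto
    then show ?thesis using \<pi>[OF G_sub[OF that]] by simp
  qed
  have "well_chain ?\<Phi> {\<zero>\<^bsub>?Q\<^esub>} (?G \<mu>) ?\<C>"
  proof (rule well_chain_image[OF r mu])
    show "?G \<alpha> \<subseteq> ?G \<beta>" if "\<beta> \<in> under r \<mu>" "\<alpha> \<in> under r \<beta>" for \<alpha> \<beta>
      using G_mono[OF that] by (rule image_mono)
    \<comment> \<open>The zero of the quotient is the coset \<open>S\<close>, so the zero submodule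
      is the singleton of \<open>S\<close>.\<close>
    have "?\<pi> x = S" if "x \<in> S" for x
      using coset_eq_self_iff[OF S_sub] submoduleE(1)[OF S_sub] that by blast
    then have "?\<pi> ` S = {S}" using submoduleE(2)[OF S_sub] by auto
    then show "?G \<nu> = {\<zero>\<^bsub>?Q\<^esub>}" if "\<nu> \<in> under r \<mu>" "is_zero_ord r \<nu>" for \<nu>
      using G_zero[OF that] by simp
    show "?G \<nu> \<subseteq> (\<Union>\<alpha>\<in>underS r \<nu>. ?G \<alpha>)" if "\<nu> \<in> under r \<mu>" "is_limit_ord r \<nu>" for \<nu>
      using G_limit[OF that] by blast
    show "?G (sc \<alpha>) = ?G \<alpha> \<or> ?\<Phi> (?G \<alpha>) (?G (sc \<alpha>))" if \<alpha>: "\<alpha> \<in> underS r \<mu>" for \<alpha>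
    proof -
      note a = sc_facts[OF \<alpha>]
      show ?thesis
        using G_suc[OF \<alpha>]
      proof
        assume "\<exists>X\<in>\<X>. subfactor R M X (G \<alpha>) (G (sc \<alpha>))"
        then obtain X where X: "X \<in> \<X>" "subfactor R M X (G \<alpha>) (G (sc \<alpha>))" by blast
        show ?thesis
          using subfactor_quot_module[OF lM X_module[OF X(1)] S_sub G_sub[OF a(3)] G_sub[OF a(5)]
              S_le_G[OF a(5)] G_mono[OF a(3,2)] X(2)] X(1) by blast
      qed simp
    qed
  qed
  then have chain: "well_chain ?\<Phi> {\<zero>\<^bsub>?Q\<^esub>} (carrier ?Q) ?\<C>" by (simp add: G_top)
  have sub: "submodule C R ?Q" if "C \<in> ?\<C>" for C
    using that sub_G by blast
  have iso: "\<exists>X\<in>\<X>. lmod_iso R (quot_module (?Q\<lparr>carrier := H\<rparr>) K) X"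
    if "K \<in> ?\<C>" "H \<in> ?\<C>" "K \<subset> H" "?\<Phi> K H" for K H
  proof -
    obtain X where X: "X \<in> \<X>" "subfactor R ?Q X K H" using \<open>?\<Phi> K H\<close> by blast
    then show ?thesis
      using lmod_iso_quot_module_iff[OF mQ X_module[OF X(1)] sub[OF that(2)] sub[OF that(1)]] that(3)
      by blast
  qed
  show ?thesis
    unfolding in_Filt_def
  proof (intro conjI exI)
    show "left_module R ?Q" by (rule mQ)
    show "X_filtration R \<X> ?Q {(A, B). A \<in> ?\<C> \<and> B \<in> ?\<C> \<and> A \<subseteq> B} (carrier ?Q) (\<lambda>C. C)"
      by (rule well_chain_X_filtration(1)[where \<X> = \<X>, OF chain sub iso])
  qed
qed

section \<open>A filtration over the given well-order\<close>

lemma filtration_F: "filtration R M r \<mu> F"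
  using X_filtration unfolding X_filtration_def by simp

text \<open>This is the case \<mu> = 1: the only factor is M itself, so M is isomorphic to some X in
  \<open>\<X>\<close>, and the inverse isomorphism is a map from X whose image is M.\<close>

lemma S_eq_carrier:
  assumes z: "\<zeta> \<in> underS r \<mu>" "is_zero_ord r \<zeta>" "sc \<zeta> = \<mu>"
  shows "S = carrier M"
proof -
  obtain X where X: "X \<in> \<X>" "subfactor R M X (F \<zeta>) (F (sc \<zeta>))" by (rule F_factor[OF z(1)])
  have Fz: "F \<zeta> = {\<zero>\<^bsub>M\<^esub>}" using F_zero[OF sc_facts(5)[OF z(1)] z(2)] .
  obtain \<phi> where \<phi>: "\<phi> \<in> lmod_hom R M X" "\<phi> ` carrier M = carrier X"
    "{x \<in> carrier M. \<phi> x = \<zero>\<^bsub>X\<^esub>} = {\<zero>\<^bsub>M\<^esub>}"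
    using X(2) unfolding subfactor_def z(3) F_top Fz by auto
  note mX = X_module[OF X(1)]
  interpret X: left_module R X by (rule mX)
  have "inj_on \<phi> (carrier M)"
  proof (rule inj_onI)
    fix x y assume xy: "x \<in> carrier M" "y \<in> carrier M" "\<phi> x = \<phi> y"
    then have "\<phi> (x \<ominus>\<^bsub>M\<^esub> y) = \<zero>\<^bsub>X\<^esub>"
      using lmod_hom_minus[OF lM mX \<phi>(1) xy(1,2)] lmod_homD(1)[OF \<phi>(1) xy(2)]
      by (simp add: a_minus_def X.M.r_neg)
    then have "x \<ominus>\<^bsub>M\<^esub> y = \<zero>\<^bsub>M\<^esub>" using \<phi>(3) xy(1,2) M.minus_closed by blast
    then show "x = y" using M.minus_eq_zeroD xy(1,2) by blast
  qed
  then have "bij_betw \<phi> (carrier M) (carrier X)" using \<phi>(2) by (simp add: bij_betw_def)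
  then obtain g where g: "g \<in> lmod_hom R X M" "\<And>x. x \<in> carrier M \<Longrightarrow> g (\<phi> x) = x"
    using inv_lmod_hom[OF lM mX \<phi>(1)] by blast
  have "g ` carrier X \<subseteq> F \<mu>" using lmod_homD(1)[OF g(1)] F_top by auto
  then have "g ` carrier X \<subseteq> S" unfolding S_def by (rule im_le_P[OF mu_refl X(1) g(1)])
  moreover have "carrier M \<subseteq> g ` carrier X"
  proof
    fix x assume "x \<in> carrier M"
    then show "x \<in> g ` carrier X" using g(2) lmod_homD(1)[OF \<phi>(1)] by (metis imageI)
  qed
  ultimately show ?thesis using submoduleE(1)[OF S_sub] by blast
qed

text \<open>
  The factors of this filtration are unconstrained, so \<open>0 \<subseteq> S \<subseteq> M \<subseteq> M \<subseteq> \<dots>\<close> works as soon as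
  \<open>\<mu> \<ge> 2\<close>; for \<open>\<mu> \<le> 1\<close> the socle is \<open>0\<close> or \<open>M\<close>.
\<close>

lemma filtration_through_socle:
  "\<exists>N \<xi>. filtration R M r \<mu> N \<and> \<xi> \<in> under r \<mu> \<and> N \<xi> = S"
proof -
  obtain \<zeta> where z: "\<zeta> \<in> under r \<mu>" "\<And>\<beta>. \<beta> \<in> under r \<mu> \<Longrightarrow> \<zeta> \<in> under r \<beta>"
    using well_order_least[OF r subset_refl, of \<mu>] mu_refl by blast
  have anti: "antisym r" using r by (simp add: order_on_defs)
  have z0: "underS r \<zeta> = {}"
  proof (rule equals0I)
    fix \<beta> assume b: "\<beta> \<in> underS r \<zeta>"
    then have "\<zeta> \<in> under r \<beta>" using z(2) under_trans[OF r underS_under[OF b] z(1)] by blast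
    then show False using b anti by (auto simp: underS_def under_def antisym_def)
  qed
  then have zero: "is_zero_ord r \<zeta>"
    using z(1) by (auto simp: is_zero_ord_def under_def Field_def)
  have Fz: "F \<zeta> = {\<zero>\<^bsub>M\<^esub>}" using F_zero[OF z(1) zero] .
  \<comment> \<open>In the first two cases \<open>F\<close> itself serves, with \<xi> = \<mu> and
    \<xi> = 0; in the third, \<mu> \<ge> 2 leaves room for \<open>S\<close> at stage 1.\<close>
  consider "S = carrier M" | "S = {\<zero>\<^bsub>M\<^esub>}" | "S \<noteq> carrier M" "S \<noteq> {\<zero>\<^bsub>M\<^esub>}" by blast
  then show ?thesis
  proof cases
    case 1
    then show ?thesis using filtration_F mu_refl F_top by blast
  next
    case 2
    then show ?thesis using filtration_F z(1) Fz by blast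
  next
    case 3
    have "\<zeta> \<noteq> \<mu>"
      using 3 Fz F_top submoduleE(1,2)[OF S_sub] by auto
    then have zm: "\<zeta> \<in> underS r \<mu>" using z(1) by (simp add: under_def underS_def)
    note s = sc_facts[OF zm]
    \<comment> \<open>\<open>?o\<close> is the ordinal 1. It differs from \<mu>, as otherwise
      \<open>S\<close> would be the whole module.\<close>
    let ?o = "sc \<zeta>"
    have "?o \<noteq> \<mu>" using S_eq_carrier[OF zm zero] 3 by blast
    then have om: "?o \<in> underS r \<mu>" using s(3) by (simp add: under_def underS_def)
    have zo: "\<zeta> \<noteq> ?o" using s(1) by (simp add: underS_def)
    have under_z: "\<beta> = \<zeta>" if "\<beta> \<in> under r \<zeta>" for \<beta>
      using that z0 by (auto simp: under_def underS_def)
    have under_o: "\<beta> = \<zeta> \<or> \<beta> = ?o" if "\<beta> \<in> under r ?o" for \<beta>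
      using that under_z s(4) by (auto simp: under_def underS_def)
    define N where "N \<alpha> = (if \<alpha> = \<zeta> then {\<zero>\<^bsub>M\<^esub>} else if \<alpha> = ?o then S else carrier M)" for \<alpha>
    have N_sub: "submodule (N \<alpha>) R M" for \<alpha>
      using zero_is_submodule S_sub carrier_is_submodule by (simp add: N_def)
    have "filtration R M r \<mu> N"
      unfolding filtration_def
    proof (intro conjI ballI impI)
      show "Well_order r" by (rule r)
      show "\<mu> \<in> Field r" by (rule mu)
      show "\<And>\<alpha>. submodule (N \<alpha>) R M" by (rule N_sub)
      show "N \<mu> = carrier M" using \<open>\<zeta> \<noteq> \<mu>\<close> \<open>?o \<noteq> \<mu>\<close> by (auto simp: N_def)
    next
      fix \<beta> \<alpha> assume b: "\<beta> \<in> under r \<mu>" "\<alpha> \<in> under r \<beta>"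
      consider "\<alpha> = \<zeta>" | "\<alpha> = ?o" "\<beta> \<noteq> \<zeta>" | "\<beta> \<noteq> \<zeta>" "\<beta> \<noteq> ?o"
        using under_z under_o b(2) zo by metis
      then show "N \<alpha> \<subseteq> N \<beta>"
      proof cases
        case 1
        then show ?thesis using submoduleE(2)[OF N_sub[of \<beta>]] 1 by (simp add: N_def[of \<zeta>])
      next
        case 2
        then show ?thesis using submoduleE(1)[OF S_sub] zo by (auto simp: N_def)
      next
        case 3
        then show ?thesis using submoduleE(1)[OF N_sub[of \<alpha>]] by (simp add: N_def[of \<beta>])
      qed
    next
      fix \<nu> assume n: "\<nu> \<in> under r \<mu>" "is_zero_ord r \<nu>"
      have "\<nu> = \<zeta>" using z(2)[OF n(1)] n(2) by (auto simp: is_zero_ord_def under_def underS_def)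
      then show "N \<nu> = {\<zero>\<^bsub>M\<^esub>}" by (simp add: N_def)
    next
      fix \<nu> assume n: "\<nu> \<in> under r \<mu>" "is_limit_ord r \<nu>"
      have nz: "\<nu> \<noteq> \<zeta>" using n(2) z0 by (auto simp: is_limit_ord_def)
      then have zn: "\<zeta> \<in> underS r \<nu>" using z(2)[OF n(1)] by (simp add: under_def underS_def)
      have on: "?o \<in> underS r \<nu>" using limit_ord_suc[OF r n(2) zn] .
      \<comment> \<open>\<open>sc ?o\<close> is the ordinal 2. There \<open>N\<close> has already
        reached M, so the union below any limit is M.\<close>
      have oon: "sc ?o \<in> underS r \<nu>" using limit_ord_suc[OF r n(2) on] .
      have o1: "?o \<in> underS r (sc ?o)" using suc_ord(1)[OF r on] .
      have "sc ?o \<noteq> ?o" using o1 by (auto simp: underS_def)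
      moreover have "sc ?o \<noteq> \<zeta>" using o1 z0 by (metis empty_iff)
      ultimately have "N (sc ?o) = carrier M" by (simp add: N_def)
      moreover have "?o \<noteq> \<nu>" using on by (simp add: underS_def)
      then have "N \<nu> = carrier M" using nz by (simp add: N_def)
      moreover have "(\<Union>\<alpha>\<in>underS r \<nu>. N \<alpha>) \<subseteq> carrier M"
        using submoduleE(1)[OF N_sub] by (rule UN_least)
      moreover have "N (sc ?o) \<subseteq> (\<Union>\<alpha>\<in>underS r \<nu>. N \<alpha>)" using oon by (rule UN_upper)
      ultimately show "N \<nu> = (\<Union>\<alpha>\<in>underS r \<nu>. N \<alpha>)" by simp
    qed
    moreover have "N ?o = S" using zo by (simp add: N_def)
    ultimately show ?thesis using s(3) by blast
  qed
qed

end

theorem proposition3p3: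
  fixes R :: "('a, 'r) ring_scheme"
    and \<X> :: "('a, 'x) module set"
    and M :: "('a, 'b) module"
    and r :: "'i rel" and \<mu> :: 'i and F :: "'i \<Rightarrow> 'b set"
  assumes "ring R"
    and "semibrick R \<X>"
    and "left_module R M"
    and "X_filtration R \<X> M r \<mu> F"
  shows "(\<exists>N \<xi>. filtration R M r \<mu> N \<and> \<xi> \<in> under r \<mu> \<and> N \<xi> = X_socle R \<X> M) \<and>
    (\<exists>(s :: 'b set rel) \<nu> N \<xi>.
      X_filtration R \<X> M s \<nu> N \<and> \<xi> \<in> under s \<nu> \<and> N \<xi> = X_socle R \<X> M) \<and>
    in_Filt R \<X> (quot_module M (X_socle R \<X> M))"
proof -
  interpret semibrick_filtration R M \<X> r \<mu> F
    using assms(2-4) by (intro semibrick_filtration.intro semibrick_filtration_axioms.intro)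
  show ?thesis
    unfolding X_socle_eq[folded S_def]
    using filtration_through_socle X_filtration_through_socle in_Filt_quot by (intro conjI)
qed

end
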